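(* Let $(\mathcal A,\mathcal C,E,\alpha^* )$ be a covariant positive flow with phase space $X$ and (finite) spectral potential $\lambda$. Let $L\subset C(X)$ be a vector subspace, $\varphi,\psi\in L$, let $\nu$ be a state that is both $\varphi$-sensitive and $\psi$-sensitive, and put $P_n=\nu(\,\cdot\,E_\varphi^n)/\nu(E_\varphi^n)$. If the set $M_\psi^L$ consists of only one element $u$, then for any $\varepsilon>0$ there exists a ( *-weak) neighborhood $O(u)\subset L^*$ of $u$ such that for all sufficiently large $n$ $$e^{n(\tau-\varepsilon)}<P_n\bigl\{x\in X\bigm|\delta_{x,n}|_L\in O(u)\bigr\}<e^{n(\tau+\varepsilon)},$$ where $\tau=\tau_\varphi^L(u)=\lambda(\psi)-\lambda(\varphi)-u(\psi-\varphi)$.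
   Context: All algebras are real and associative. A cone in a real vector space is a convex subset $K$ with $tK\subset K$ for $t\ge0$ and such that $v,-v\in K$ imply $v=0$; $u\le v$ means $v-u\in K$. A positive algebra is a real normed algebra $\mathcal A$ ($\|ab\|\le\|a\|\|b\|$) with unit $I$, $\|I\|=1$, and a cone $\mathcal A_+$ closed under products and containing $I$, whose norm is monotone: $\|u\|\le\|u+v\|$ for $u,v\in\mathcal A_+$. A phase subalgebra $\mathcal C\subset\mathcal A$ is a commutative subalgebra containing $I$ such that each $a\in\mathcal C$ satisfies $-tI\le a\le tI$ for some $t>0$. If $\mathcal A_+$ is closed, there is a Hausdorff compact set $X$, unique up to homeomorphism (the phase space), such that $\mathcal C$ is isomorphic, including the order, to a dense subalgebra of $C(X)$ (real continuous functions, supremum norm); $\mathcal C$ is identified with this subalgebra. When $\mathcal A$ is moreover complete, the inclusion $\mathcal C\to\mathcal A$ extends uniquely to a continuous, injective, positive homomorphism $C(X)\to\mathcal A$, by which $C(X)$ is regarded as a subalgebra of $\mathcal A$. A covariant positive flow $(\mathcal A,\mathcal C,E,\alpha^* )$ consists of a positive algebra $\mathcal A$, complete in norm, with closed cone $\mathcal A_+$; a phase subalgebra $\mathcal C$ with phase space $X$; an element $E\in\mathcal A_+$; and a positive unital homomorphism $\alpha^*:\mathcal C\to\mathcal C$ with $Ef=\alpha^*(f)E$ for all $f\in\mathcal C$. There is a unique continuous $\alpha:X\to X$ with $\alpha^*(f)=f\circ\alpha$. For $\varphi\in C(X)$ put $E_\varphi=e^\varphi E$. The spectral potential is $\lambda(\varphi)=\lim_{n\to\infty}\frac1n\ln\|E_\varphi^n\|$;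 standing assumption: $\lambda$ is finite on $C(X)$ (otherwise $\lambda\equiv-\infty$). The functional $\lambda$ is convex and continuous. A state is a positive continuous linear functional $\nu$ on $\mathcal A$; it is $\varphi$-sensitive if $\lim_{n\to\infty}\frac1n\ln\nu(E_\varphi^n)=\lambda(\varphi)$. $P_n$ is the Borel probability measure on $X$ given (Riesz theorem) by $P_n(g)=\nu(gE_\varphi^n)/\nu(E_\varphi^n)$, $g\in C(X)$, defined for all sufficiently large $n$. Empirical measures: $\delta_{x,n}(f)=\frac1n\sum_{i=0}^{n-1}f(\alpha^i(x))$, $f\in C(X)$. For $\mu\in C^*(X)$: the dual entropy is $S(\mu)=\inf_{\psi\in C(X)}(\lambda(\psi)-\mu(\psi))\in[-\infty,\infty)$ and the action functional is $\tau_\varphi(\mu)=\mu(\varphi)+S(\mu)-\lambda(\varphi)$. $L$ carries the supremum norm and $L^*$ is its continuous dual; $\tau_\varphi^L(u)=\sup\{\tau_\varphi(\mu)\mid\mu\in C^*(X),\ \mu|_L=u\}$, $u\in L^*$. $M_\psi^L\subset L^*$ is the set of all subgradients of the restriction $\lambda|_L$ at $\psi\in L$, i.e. of $u\in L^*$ with $\lambda(\psi+\chi)-\lambda(\psi)\ge u(\chi)$ for all $\chi\in L$. *)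

theory Defs
  imports "HOL-Analysis.Analysis" "HOL-Probability.Probability_Measure"
begin

text \<open>
  The algebra is a type of class real_normed_algebra_1 and banach (submultiplicative complete
  norm, unit of norm 1), and its positive cone is a set \<open>K\<close>; \<open>u \<le> v\<close> means \<open>v - u \<in> K\<close>.
\<close>

definition positive_algebra :: "'a::real_normed_algebra_1 set \<Rightarrow> bool" where
  "positive_algebra K \<longleftrightarrow>
     convex K \<and> cone K \<and> (\<forall>v. v \<in> K \<longrightarrow> - v \<in> K \<longrightarrow> v = 0) \<and>
     1 \<in> K \<and> (\<forall>u\<in>K. \<forall>v\<in>K. u * v \<in> K) \<and>
     (\<forall>u\<in>K. \<forall>v\<in>K. norm u \<le> norm (u + v))"

definition phase_subalgebra :: "'a::real_normed_algebra_1 set \<Rightarrow> 'a set \<Rightarrow> bool" where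
  "phase_subalgebra K C \<longleftrightarrow>
     subspace C \<and> 1 \<in> C \<and> (\<forall>a\<in>C. \<forall>b\<in>C. a * b \<in> C \<and> a * b = b * a) \<and>
     (\<forall>a\<in>C. \<exists>t>0. a - (- t *\<^sub>R 1) \<in> K \<and> t *\<^sub>R 1 - a \<in> K)"

definition covariant_positive_flow ::
    "'a::{real_normed_algebra_1, banach} set \<Rightarrow> 'a set \<Rightarrow> 'a \<Rightarrow> ('a \<Rightarrow> 'a) \<Rightarrow> bool" where
  "covariant_positive_flow K C E \<alpha>s \<longleftrightarrow>
     positive_algebra K \<and> closed K \<and> phase_subalgebra K C \<and> E \<in> K \<and>
     (\<forall>f\<in>C. \<alpha>s f \<in> C) \<and> \<alpha>s 1 = 1 \<and>
     (\<forall>f\<in>C. \<forall>g\<in>C. \<alpha>s (f + g) = \<alpha>s f + \<alpha>s g \<and> \<alpha>s (f * g) = \<alpha>s f * \<alpha>s g) \<and>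
     (\<forall>f\<in>C. \<forall>c. \<alpha>s (c *\<^sub>R f) = c *\<^sub>R \<alpha>s f) \<and>
     (\<forall>f\<in>C. f \<in> K \<longrightarrow> \<alpha>s f \<in> K) \<and>
     (\<forall>f\<in>C. E * f = \<alpha>s f * E)"

text \<open>
  The phase space \<open>X\<close> is the compact Hausdorff type \<open>'x\<close>, with \<open>C(X)\<close> the normed space
  \<open>'x \<Rightarrow>\<^sub>C real\<close>. The map \<open>\<rho>\<close>, relevant only on \<open>C\<close>, is the algebra and order isomorphism of \<open>C\<close>
  onto a dense subalgebra of \<open>C(X)\<close> by which \<open>C\<close> is identified with that subalgebra.
\<close>

definition phase_isomorphism ::
    "'a::real_normed_algebra_1 set \<Rightarrow> 'a set \<Rightarrow> ('a \<Rightarrow> ('x::t2_space \<Rightarrow>\<^sub>C real)) \<Rightarrow> bool" where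
  "phase_isomorphism K C \<rho> \<longleftrightarrow>
     compact (UNIV :: 'x set) \<and>
     inj_on \<rho> C \<and> closure (\<rho> ` C) = UNIV \<and>
     (\<forall>f\<in>C. \<forall>g\<in>C. \<rho> (f + g) = \<rho> f + \<rho> g \<and> (\<forall>x. \<rho> (f * g) x = \<rho> f x * \<rho> g x)) \<and>
     (\<forall>f\<in>C. \<forall>c. \<rho> (c *\<^sub>R f) = c *\<^sub>R \<rho> f) \<and> (\<forall>x. \<rho> 1 x = 1) \<and>
     (\<forall>f\<in>C. f \<in> K \<longleftrightarrow> (\<forall>x. 0 \<le> \<rho> f x))"

text \<open>
  The continuous extension \<open>C(X) \<rightarrow> A\<close> of the inclusion \<open>C \<rightarrow> A\<close>. For a complete positive algebra
  with closed cone it exists, is unique because \<open>C\<close> is dense in \<open>C(X)\<close>, and is automatically an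
  injective positive homomorphism.
\<close>

definition phase_embedding ::
    "'a::{real_normed_algebra_1, banach} set \<Rightarrow> ('a \<Rightarrow> ('x::t2_space \<Rightarrow>\<^sub>C real)) \<Rightarrow>
     ('x \<Rightarrow>\<^sub>C real) \<Rightarrow> 'a" where
  "phase_embedding C \<rho> = (THE j. continuous_on UNIV j \<and> (\<forall>f\<in>C. j (\<rho> f) = f))"

definition phase_map ::
    "'a::real_normed_algebra_1 set \<Rightarrow> ('a \<Rightarrow> ('x::t2_space \<Rightarrow>\<^sub>C real)) \<Rightarrow> ('a \<Rightarrow> 'a) \<Rightarrow> 'x \<Rightarrow> 'x" where
  "phase_map C \<rho> \<alpha>s =
     (THE \<alpha>. continuous_on UNIV \<alpha> \<and> (\<forall>f\<in>C. \<forall>x. \<rho> (\<alpha>s f) x = \<rho> f (\<alpha> x)))"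

text \<open>Below, \<open>j\<close> stands for the embedding of \<open>C(X)\<close> into the algebra.\<close>

definition weighted ::
    "(('x::topological_space \<Rightarrow>\<^sub>C real) \<Rightarrow> 'a::real_normed_algebra_1) \<Rightarrow> 'a \<Rightarrow>
     ('x \<Rightarrow>\<^sub>C real) \<Rightarrow> 'a" where
  "weighted j E \<phi> = j (Bcontfun (\<lambda>x. exp (\<phi> x))) * E"

text \<open>The logarithm on \<open>[0,\<infinity>)\<close> with \<open>ln 0 = -\<infinity>\<close> (in HOL the real \<open>ln 0\<close> is \<open>0\<close>).\<close>

definition eln :: "real \<Rightarrow> ereal" where
  "eln t = (if t \<le> 0 then -\<infinity> else ereal (ln t))"

definition ext_spectral_potential ::
    "(('x::topological_space \<Rightarrow>\<^sub>C real) \<Rightarrow> 'a::real_normed_algebra_1) \<Rightarrow> 'a \<Rightarrow>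
     ('x \<Rightarrow>\<^sub>C real) \<Rightarrow> ereal" where
  "ext_spectral_potential j E \<phi> =
     lim (\<lambda>n. ereal (1 / real n) * eln (norm (weighted j E \<phi> ^ n)))"

text \<open>The real-valued potential, meaningful only where the extended one is finite.\<close>

definition spectral_potential ::
    "(('x::topological_space \<Rightarrow>\<^sub>C real) \<Rightarrow> 'a::real_normed_algebra_1) \<Rightarrow> 'a \<Rightarrow>
     ('x \<Rightarrow>\<^sub>C real) \<Rightarrow> real" where
  "spectral_potential j E \<phi> = real_of_ereal (ext_spectral_potential j E \<phi>)"

definition state :: "'a::real_normed_algebra_1 set \<Rightarrow> ('a \<Rightarrow>\<^sub>L real) \<Rightarrow> bool" where
  "state K \<nu> \<longleftrightarrow> (\<forall>a\<in>K. 0 \<le> \<nu> a)"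

definition sensitive ::
    "(('x::topological_space \<Rightarrow>\<^sub>C real) \<Rightarrow> 'a::real_normed_algebra_1) \<Rightarrow> 'a \<Rightarrow>
     ('a \<Rightarrow>\<^sub>L real) \<Rightarrow> ('x \<Rightarrow>\<^sub>C real) \<Rightarrow> bool" where
  "sensitive j E \<nu> \<phi> \<longleftrightarrow>
     (\<lambda>n. ereal (1 / real n) * eln (\<nu> (weighted j E \<phi> ^ n)))
       \<longlonglongrightarrow> ext_spectral_potential j E \<phi>"

text \<open>
  The regular Borel probability measure representing the functional \<open>\<Lambda>\<close> on \<open>C(X)\<close> in the Riesz
  theorem. Regularity is what makes it unique when \<open>X\<close> is not metrizable.
\<close>

definition riesz_prob :: "'x::t2_space measure \<Rightarrow> (('x \<Rightarrow>\<^sub>C real) \<Rightarrow> real) \<Rightarrow> bool" where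
  "riesz_prob M \<Lambda> \<longleftrightarrow>
     sets M = sets borel \<and> prob_space M \<and>
     (\<forall>B\<in>sets borel. emeasure M B = (SUP F\<in>{F. F \<subseteq> B \<and> compact F}. emeasure M F)) \<and>
     (\<forall>B\<in>sets borel. emeasure M B = (INF U\<in>{U. B \<subseteq> U \<and> open U}. emeasure M U)) \<and>
     (\<forall>g. (\<integral>x. apply_bcontfun g x \<partial>M) = \<Lambda> g)"

definition empirical ::
    "('x::topological_space \<Rightarrow> 'x) \<Rightarrow> nat \<Rightarrow> 'x \<Rightarrow> ('x \<Rightarrow>\<^sub>C real) \<Rightarrow> real" where
  "empirical \<alpha> n x f = (1 / real n) * (\<Sum>i<n. f ((\<alpha> ^^ i) x))"

text \<open>
  The continuous dual of the subspace \<open>L\<close>. Functionals on \<open>L\<close> are functions with the value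
  \<open>undefined\<close> outside \<open>L\<close>, so equality of functionals is equality on \<open>L\<close> and \<open>\<mu>|\<^sub>L\<close> is
  \<open>restrict \<mu> L\<close>.
\<close>

definition dual_on :: "'b::real_normed_vector set \<Rightarrow> ('b \<Rightarrow> real) set" where
  "dual_on L = {u \<in> extensional L.
     (\<forall>f\<in>L. \<forall>g\<in>L. u (f + g) = u f + u g) \<and>
     (\<forall>f\<in>L. \<forall>c. u (c *\<^sub>R f) = c * u f) \<and>
     (\<exists>B. \<forall>f\<in>L. \<bar>u f\<bar> \<le> B * norm f)}"

text \<open>The *-weak topology is that of pointwise convergence on \<open>L\<close>.\<close>

definition weak_star :: "'b::real_normed_vector set \<Rightarrow> ('b \<Rightarrow> real) topology" where
  "weak_star L = subtopology (product_topology (\<lambda>_. euclideanreal) L) (dual_on L)"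

definition dual_entropy ::
    "('b::real_normed_vector \<Rightarrow> real) \<Rightarrow> ('b \<Rightarrow>\<^sub>L real) \<Rightarrow> ereal" where
  "dual_entropy lam \<mu> = (INF \<psi>. ereal (lam \<psi> - \<mu> \<psi>))"

definition action ::
    "('b::real_normed_vector \<Rightarrow> real) \<Rightarrow> 'b \<Rightarrow> ('b \<Rightarrow>\<^sub>L real) \<Rightarrow> ereal" where
  "action lam \<phi> \<mu> = ereal (\<mu> \<phi>) + dual_entropy lam \<mu> - ereal (lam \<phi>)"

definition action_on ::
    "'b::real_normed_vector set \<Rightarrow> ('b \<Rightarrow> real) \<Rightarrow> 'b \<Rightarrow> ('b \<Rightarrow> real) \<Rightarrow> ereal" where
  "action_on L lam \<phi> u = Sup {action lam \<phi> \<mu> | \<mu>. restrict (blinfun_apply \<mu>) L = u}"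

definition subgradients_on ::
    "'b::real_normed_vector set \<Rightarrow> ('b \<Rightarrow> real) \<Rightarrow> 'b \<Rightarrow> ('b \<Rightarrow> real) set" where
  "subgradients_on L lam \<psi> = {u \<in> dual_on L. \<forall>\<eta>\<in>L. lam (\<psi> + \<eta>) - lam \<psi> \<ge> u \<eta>}"

end

(*
  Write S_n f for the Birkhoff sum of f under alpha. Covariance gives E_phi^n = e^(S_n phi) E^n, so
  that P_n(e^(S_n (xi - phi))) = nu(E_xi^n) / nu(E_phi^n) for every xi. For eta = psi - phi the
  exponential moments of delta_{x,n}(eta) under P_n therefore grow at most at the rates
  lambda(phi + c eta) - lambda(phi), and exactly at this rate for c = 1 by sensitivity.

  By Hahn-Banach the one-sided directional derivatives of the convex function lambda at psi along L
  are values of subgradients. If u is the only one, lambda is differentiable at psi in the direction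
  eta with derivative u(eta). Hence tilting P_n by e^(n delta_{x,n}(eta)) concentrates
  delta_{x,n}(eta) at u(eta), and undoing the tilt costs the factor e^(n tau). The neighborhood O(u)
  thus has to control the single value at eta only.
*)
theory Submission
  imports Defs "HOL-Real_Asymp.Real_Asymp"
begin

section \<open>Sublinear functionals\<close>

text \<open>Away from \<open>c = 1\<close> only upper bounds on exponential moments are available.
  They suffice, since the exponents \<open>1 + t\<close> and \<open>1 - s\<close> serve only to
  bound tails. So one step size on each side, with a small slack in the slope, replaces
  differentiation, and no limit of difference quotients is formed.

  Hahn-Banach is needed in two ways: a subgradient on \<open>L\<close> is extended to
  \<open>C(X)\<close> to evaluate the supremum defining the action functional on \<open>L\<close>,
  and a subgradient is made to reach a given directional derivative. Both are lower constraints on a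
  convex cone of pairs (vector, value): the graph of a functional on \<open>L\<close> in one case, a
  ray in the other.

  The embedding of \<open>C(X)\<close>, the phase map and the spectral potential are introduced by
  description or as a \<open>lim\<close>, so each tells something only after existence is shown: by
  Lipschitz extension from a dense subalgebra, by identifying positive characters with points, and
  by Fekete's lemma. The Lipschitz constant 1 of the potential makes all linear functionals below
  its directional derivatives continuous.\<close>

definition sublinear :: "('v::real_vector \<Rightarrow> real) \<Rightarrow> bool" where
  "sublinear p \<longleftrightarrow> (\<forall>x y. p (x + y) \<le> p x + p y) \<and> (\<forall>t\<ge>0. \<forall>x. p (t *\<^sub>R x) = t * p x)"

lemma sublinear_add: "sublinear p \<Longrightarrow> p (x + y) \<le> p x + p y"
  and sublinear_scaleR: "sublinear p \<Longrightarrow> t \<ge> 0 \<Longrightarrow> p (t *\<^sub>R x) = t * p x"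
  by (simp_all add: sublinear_def)

lemma sublinear_0: "sublinear p \<Longrightarrow> p 0 = 0"
  using sublinear_scaleR[of p 0 0] by simp

lemma sublinear_minus: "sublinear p \<Longrightarrow> - p (- x) \<le> p x"
  using sublinear_add[of p x "- x"] by (simp add: sublinear_0)

lemma sublinear_le_minus:
  assumes "sublinear q" "q \<le> p"
  shows "- p (- x) \<le> q x"
  using sublinear_minus[OF assms(1), of x] le_funD[OF assms(2), of "- x"] by simp

text \<open>One inequality is enough for homogeneity: used for the factor \<open>1/t\<close> at
  \<open>t *\<^sub>R x\<close>, it gives the reverse one.\<close>

lemma sublinearI:
  assumes "\<And>x y. p (x + y) \<le> p x + p y" "p 0 = 0" "\<And>t x. t > 0 \<Longrightarrow> p (t *\<^sub>R x) \<le> t * p x"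
  shows "sublinear p"
proof -
  have "p (t *\<^sub>R x) = t * p x" if "t > 0" for t x
    using assms(3)[of t x] assms(3)[of "1/t" "t *\<^sub>R x"] that by (simp add: field_simps)
  then show ?thesis
    using assms by (auto simp: sublinear_def le_less)
qed

text \<open>The infimum of \<open>p (x + y) - c\<close> over \<open>G\<close> is the largest
  sublinear functional that satisfies the two requirements; \<open>c \<le> p y\<close> keeps it
  finite. A linear functional below it satisfies \<open>f (- y) \<le> - c\<close>, that is
  \<open>c \<le> f y\<close>, so lower constraints become part of the majorant.\<close>

lemma sublinear_below_on_cone:
  fixes p :: "'v::real_vector \<Rightarrow> real"
  assumes p: "sublinear p"
    and G0: "(0, 0) \<in> G"
    and Gadd: "\<And>y c z d. (y, c) \<in> G \<Longrightarrow> (z, d) \<in> G \<Longrightarrow> (y + z, c + d) \<in> G"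
    and Gscale: "\<And>y c t. (y, c) \<in> G \<Longrightarrow> t > 0 \<Longrightarrow> (t *\<^sub>R y, t * c) \<in> G"
    and Gp: "\<And>y c. (y, c) \<in> G \<Longrightarrow> c \<le> p y"
  shows "\<exists>q. sublinear q \<and> q \<le> p \<and> (\<forall>(y, c)\<in>G. q (- y) \<le> - c)"
proof -
  define q where "q x = (INF g\<in>G. p (x + fst g) - snd g)" for x
  have low: "- p (- x) \<le> p (x + y) - c" if "(y, c) \<in> G" for x y c
    using sublinear_add[OF p, of "x + y" "- x"] Gp[OF that] by (simp add: algebra_simps)
  then have bdd: "bdd_below ((\<lambda>g. p (x + fst g) - snd g) ` G)" for x
    by (intro bdd_belowI2[of _ "- p (- x)"]) auto
  have lower: "q x \<le> p (x + y) - c" if "(y, c) \<in> G" for x y c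
    unfolding q_def using cINF_lower[OF bdd that] by simp
  have greatest: "b \<le> q x" if "\<And>y c. (y, c) \<in> G \<Longrightarrow> b \<le> p (x + y) - c" for b x
    unfolding q_def by (rule cINF_greatest) (use G0 that in auto)
  have "sublinear q"
  proof (rule sublinearI)
    fix x y
    have "q (x + y) - (p (y + z) - d) \<le> q x" if "(z, d) \<in> G" for z d
    proof (rule greatest)
      fix w c assume "(w, c) \<in> G"
      have "q (x + y) \<le> p ((x + y) + (w + z)) - (c + d)"
        by (intro lower Gadd) fact+
      also have "\<dots> \<le> p (x + w) + p (y + z) - (c + d)"
        using sublinear_add[OF p, of "x + w" "y + z"] by (simp add: algebra_simps)
      finally show "q (x + y) - (p (y + z) - d) \<le> p (x + w) - c" by simp
    qed
    then have "q (x + y) - q x \<le> q y"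
      by (intro greatest) (auto simp: algebra_simps)
    then show "q (x + y) \<le> q x + q y" by simp
  next
    show "q 0 = 0"
      using lower[OF G0, of 0] greatest[of 0 0] Gp by (simp add: sublinear_0[OF p])
  next
    fix t :: real and x assume t: "t > 0"
    have "q (t *\<^sub>R x) / t \<le> q x"
    proof (rule greatest)
      fix y c assume "(y, c) \<in> G"
      then have "q (t *\<^sub>R x) \<le> p (t *\<^sub>R x + t *\<^sub>R y) - t * c"
        using Gscale lower t by blast
      also have "\<dots> = t * (p (x + y) - c)"
        using sublinear_scaleR[OF p, of t "x + y"] t by (simp add: algebra_simps)
      finally show "q (t *\<^sub>R x) / t \<le> p (x + y) - c" using t by (simp add: field_simps)
    qed
    then show "q (t *\<^sub>R x) \<le> t * q x" using t by (simp add: field_simps)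
  qed
  moreover have "q \<le> p"
    using lower[OF G0] by (auto simp: le_fun_def)
  moreover have "q (- y) \<le> - c" if "(y, c) \<in> G" for y c
    using lower[OF that, of "- y"] by (simp add: sublinear_0[OF p])
  ultimately show ?thesis by blast
qed

text \<open>Zorn's lemma for the reversed pointwise order. A chain is bounded below by its pointwise
  infimum, which is finite because every member dominates \<open>- p (- x)\<close>.\<close>

lemma minimal_sublinear_exists:
  fixes p :: "'v::real_vector \<Rightarrow> real"
  assumes p: "sublinear p"
  shows "\<exists>m. sublinear m \<and> m \<le> p \<and> (\<forall>q. sublinear q \<and> q \<le> m \<longrightarrow> q = m)"
proof -
  define Q where "Q = {q. sublinear q \<and> q \<le> p}"
  have "\<exists>m\<in>Q. \<forall>q\<in>Q. q \<le> m \<longrightarrow> q = m"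
  proof (rule predicate_Zorn[where P = "\<lambda>x y. y \<le> x"])
    show "partial_order_on Q (relation_of (\<lambda>x y. y \<le> x) Q)"
      by (rule partial_order_on_relation_ofI) auto
  next
    fix D assume D: "D \<in> Chains (relation_of (\<lambda>x y. y \<le> x) Q)"
    then have lin: "a \<le> b \<or> b \<le> a" and DQ: "a \<in> Q" if "a \<in> D" "b \<in> D" for a b
      using that unfolding Chains_def relation_of_def by auto
    show "\<exists>l\<in>Q. \<forall>a\<in>D. l \<le> a"
    proof (cases "D = {}")
      case True
      then show ?thesis using p unfolding Q_def by auto
    next
      case False
      define l where "l x = (INF a\<in>D. a x)" for x
      have bdd: "bdd_below ((\<lambda>a. a x) ` D)" for x
        using DQ by (intro bdd_belowI2[of _ "- p (- x)"]) (auto simp: Q_def sublinear_le_minus)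
      have lower: "l x \<le> a x" if "a \<in> D" for a x
        unfolding l_def by (rule cINF_lower[OF bdd that])
      have greatest: "b \<le> l x" if "\<And>a. a \<in> D \<Longrightarrow> b \<le> a x" for b x
        unfolding l_def by (rule cINF_greatest) (use False that in auto)
      have sub: "sublinear a" if "a \<in> D" for a using DQ[OF that that] by (simp add: Q_def)
      have "sublinear l"
      proof (rule sublinearI)
        fix x y
        have "l (x + y) \<le> a x + b y" if ab: "a \<in> D" "b \<in> D" for a b
        proof -
          \<comment> \<open>Comparability within the chain is essential: the smaller of
            \<open>a\<close> and \<open>b\<close> serves both arguments, whereas an infimum of
            arbitrary sublinear functionals need not be subadditive.\<close>
          obtain c where c: "c \<in> D" "c \<le> a" "c \<le> b"
            using lin[OF ab] ab by auto
          have "l (x + y) \<le> c x + c y"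
            using lower[OF c(1), of "x + y"] sublinear_add[OF sub[OF c(1)], of x y] by simp
          then show ?thesis using le_funD[OF c(2), of x] le_funD[OF c(3), of y] by simp
        qed
        then have "l (x + y) - b y \<le> l x" if "b \<in> D" for b
          using that by (intro greatest) (auto simp: algebra_simps)
        then have "l (x + y) - l x \<le> l y"
          by (intro greatest) (auto simp: algebra_simps)
        then show "l (x + y) \<le> l x + l y" by simp
      next
        have "a 0 = 0" if "a \<in> D" for a using sub[OF that] by (rule sublinear_0)
        then have "(\<lambda>a. a 0) ` D = {0}" using False by force
        then show "l 0 = 0" by (simp add: l_def)
      next
        fix t :: real and x assume t: "t > 0"
        have "l (t *\<^sub>R x) / t \<le> l x"
        proof (rule greatest)
          fix a assume "a \<in> D"
          then show "l (t *\<^sub>R x) / t \<le> a x"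
            using lower[of a "t *\<^sub>R x"] sublinear_scaleR[OF sub, of a t x] t by (simp add: field_simps)
        qed
        then show "l (t *\<^sub>R x) \<le> t * l x" using t by (simp add: field_simps)
      qed
      moreover have "l \<le> p"
      proof -
        obtain a where "a \<in> D" using False by auto
        then show ?thesis using lower[of a] DQ[of a a] by (force simp: le_fun_def Q_def intro: order_trans)
      qed
      ultimately show ?thesis using lower unfolding Q_def by (auto simp: le_fun_def)
    qed
  qed
  then show ?thesis unfolding Q_def by (force intro: order_trans)
qed

lemma minimal_sublinear_linear:
  fixes m :: "'v::real_vector \<Rightarrow> real"
  assumes m: "sublinear m" and min: "\<And>q. sublinear q \<Longrightarrow> q \<le> m \<Longrightarrow> q = m"
  shows "linear m"
proof -
  \<comment> \<open>A functional below \<open>m\<close> with \<open>q (- y) \<le> - m y\<close> is \<open>m\<close> itself.\<close>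
  have minus: "m (- y) = - m y" for y
  proof -
    define G where "G = {(t *\<^sub>R y, t * m y) | t. t \<ge> 0}"
    have "\<exists>q. sublinear q \<and> q \<le> m \<and> (\<forall>(z, c)\<in>G. q (- z) \<le> - c)"
    proof (rule sublinear_below_on_cone[OF m])
      show "(0, 0) \<in> G" unfolding G_def by force
      show "(a + b, c + d) \<in> G" if G: "(a, c) \<in> G" "(b, d) \<in> G" for a c b d
      proof -
        obtain s t where "s \<ge> 0" "t \<ge> 0" "a = s *\<^sub>R y" "c = s * m y" "b = t *\<^sub>R y" "d = t * m y"
          using G unfolding G_def by auto
        then show ?thesis
          unfolding G_def by (intro CollectI exI[of _ "s + t"]) (auto simp: algebra_simps)
      qed
      show "(t *\<^sub>R a, t * c) \<in> G" if G: "(a, c) \<in> G" and t: "t > 0" for a c t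
      proof -
        obtain s where "s \<ge> 0" "a = s *\<^sub>R y" "c = s * m y"
          using G unfolding G_def by auto
        then show ?thesis
          using t unfolding G_def by (intro CollectI exI[of _ "t * s"]) auto
      qed
      show "c \<le> m a" if "(a, c) \<in> G" for a c
        using that sublinear_scaleR[OF m] unfolding G_def by auto
    qed
    moreover have "(y, m y) \<in> G" unfolding G_def by (auto intro!: exI[of _ 1])
    ultimately have "m (- y) \<le> - m y"
      using min by fastforce
    then show ?thesis using sublinear_minus[OF m, of y] by simp
  qed
  show ?thesis
  proof (rule linearI)
    fix x y
    \<comment> \<open>Since \<open>m\<close> is odd,
      \<open>m x = m ((x + y) + (- y)) \<le> m (x + y) - m y\<close> is the inequality missing from
      subadditivity.\<close>
    show "m (x + y) = m x + m y"
      using sublinear_add[OF m, of x y] sublinear_add[OF m, of "x + y" "- y"] minus[of y] by simp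
  next
    fix c :: real and x
    show "m (c *\<^sub>R x) = c *\<^sub>R m x"
    proof (cases "c \<ge> 0")
      case False
      then show ?thesis
        using sublinear_scaleR[OF m, of "- c" x] minus[of "c *\<^sub>R x"] by simp
    qed (simp add: sublinear_scaleR[OF m])
  qed
qed

text \<open>A minimal sublinear functional is linear, so minimality below the majorant that already
  encodes \<open>G\<close> yields \<open>f\<close>. If \<open>G\<close> is the graph of a linear
  functional on a subspace, the constraint at \<open>y\<close> and \<open>- y\<close> forces
  equality and this is the extension theorem; if \<open>G\<close> is a ray, \<open>f\<close> is
  prescribed from below at one vector.\<close>

theorem Hahn_Banach_cone:
  fixes p :: "'v::real_vector \<Rightarrow> real"
  assumes p: "sublinear p"
    and G: "(0, 0) \<in> G"
      "\<And>y c z d. (y, c) \<in> G \<Longrightarrow> (z, d) \<in> G \<Longrightarrow> (y + z, c + d) \<in> G"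
      "\<And>y c t. (y, c) \<in> G \<Longrightarrow> t > 0 \<Longrightarrow> (t *\<^sub>R y, t * c) \<in> G"
      "\<And>y c. (y, c) \<in> G \<Longrightarrow> c \<le> p y"
  shows "\<exists>f. linear f \<and> f \<le> p \<and> (\<forall>(y, c)\<in>G. c \<le> f y)"
proof -
  obtain q where q: "sublinear q" "q \<le> p" "\<forall>(y, c)\<in>G. q (- y) \<le> - c"
    using sublinear_below_on_cone[OF p, of G] G by auto
  obtain f where f: "sublinear f" "f \<le> q" "\<And>q. sublinear q \<Longrightarrow> q \<le> f \<Longrightarrow> q = f"
    using minimal_sublinear_exists[OF q(1)] by auto
  have lin: "linear f" using minimal_sublinear_linear[OF f(1,3)] .
  have "c \<le> f y" if "(y, c) \<in> G" for y c
    using q(3) that le_funD[OF f(2), of "- y"] linear_neg[OF lin, of y] by auto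
  then show ?thesis using lin f(2) q(2) by (auto intro: order_trans)
qed

section \<open>Subgradients of convex functions\<close>

text \<open>For convex \<open>F\<close> this is the one-sided directional derivative at
  \<open>a\<close>. The quotients decrease as \<open>t\<close> tends to 0, so the limit is an
  infimum, and the infimum form spares a monotonicity argument.\<close>

definition directional_bound :: "('v::real_vector \<Rightarrow> real) \<Rightarrow> 'v \<Rightarrow> 'v \<Rightarrow> real" where
  "directional_bound F a x = (INF t\<in>{0<..}. (F (a + t *\<^sub>R x) - F a) / t)"

context
  fixes F :: "'v::real_normed_vector \<Rightarrow> real" and a :: 'v
  assumes convex: "convex_on UNIV F" and Lip: "\<And>x y. \<bar>F x - F y\<bar> \<le> norm (x - y)"
begin

text \<open>The Lipschitz condition keeps all quotients above \<open>- norm x\<close>, so the real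
  infimum has its two defining properties.\<close>

lemma directional_bound_lower: "t > 0 \<Longrightarrow> directional_bound F a x \<le> (F (a + t *\<^sub>R x) - F a) / t"
  and directional_bound_greatest:
    "(\<And>t. t > 0 \<Longrightarrow> b \<le> (F (a + t *\<^sub>R x) - F a) / t) \<Longrightarrow> b \<le> directional_bound F a x"
proof -
  have "- norm x \<le> (F (a + t *\<^sub>R x) - F a) / t" if "t > 0" for t
    using Lip[of a "a + t *\<^sub>R x"] that by (auto simp: field_simps)
  then have bdd: "bdd_below ((\<lambda>t. (F (a + t *\<^sub>R x) - F a) / t) ` {0<..})"
    by (intro bdd_belowI2[of _ "- norm x"]) auto
  show "t > 0 \<Longrightarrow> directional_bound F a x \<le> (F (a + t *\<^sub>R x) - F a) / t"
    unfolding directional_bound_def by (rule cINF_lower[OF bdd]) simp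
  show "(\<And>t. t > 0 \<Longrightarrow> b \<le> (F (a + t *\<^sub>R x) - F a) / t) \<Longrightarrow> b \<le> directional_bound F a x"
    unfolding directional_bound_def by (rule cINF_greatest) auto
qed

lemma directional_bound_le: "directional_bound F a x \<le> F (a + x) - F a"
  using directional_bound_lower[of 1] by simp

lemma directional_bound_le_norm: "directional_bound F a x \<le> norm x"
  using directional_bound_le[of x] Lip[of "a + x" a] by simp

lemma sublinear_directional_bound: "sublinear (directional_bound F a)"
proof (rule sublinearI)
  fix x y
  let ?d = "directional_bound F a"
  have *: "?d (x + y) \<le> (F (a + s *\<^sub>R x) - F a) / s + (F (a + t *\<^sub>R y) - F a) / t"
    if s: "s > 0" and t: "t > 0" for s t
  proof -
    \<comment> \<open>The infima for \<open>x\<close> and \<open>y\<close> run over independent step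
      sizes \<open>s\<close> and \<open>t\<close>. With this \<open>r\<close>, the point
      \<open>a + r *\<^sub>R (x + y)\<close> is the convex combination of
      \<open>a + s *\<^sub>R x\<close> and \<open>a + t *\<^sub>R y\<close> with weights
      \<open>t / (s + t)\<close> and \<open>s / (s + t)\<close>, which matches both quotients at
      once.\<close>
    define r where "r = s * t / (s + t)"
    have r: "r > 0" using s t by (simp add: r_def)
    have "s + t \<noteq> 0" using s t by simp
    then have e1: "t / (s + t) + s / (s + t) = 1"
      by (simp add: add.commute flip: add_divide_distrib)
    have e2: "(t / (s + t)) * s = r" "(s / (s + t)) * t = r"
      by (simp_all add: r_def)
    have "a + r *\<^sub>R (x + y) = (t / (s + t) + s / (s + t)) *\<^sub>R a + ((t / (s + t)) * s) *\<^sub>R x + ((s / (s + t)) * t) *\<^sub>R y"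
      unfolding e1 e2 by (simp add: algebra_simps)
    also have "\<dots> = (t / (s + t)) *\<^sub>R (a + s *\<^sub>R x) + (s / (s + t)) *\<^sub>R (a + t *\<^sub>R y)"
      by (simp only: scaleR_add_left scaleR_add_right scaleR_scaleR ac_simps)
    finally have eq: "a + r *\<^sub>R (x + y) = (t / (s + t)) *\<^sub>R (a + s *\<^sub>R x) + (s / (s + t)) *\<^sub>R (a + t *\<^sub>R y)" .
    have "F (a + r *\<^sub>R (x + y)) \<le> t / (s + t) * F (a + s *\<^sub>R x) + s / (s + t) * F (a + t *\<^sub>R y)"
      unfolding eq using convex s t e1 unfolding convex_on_def
      by (metis UNIV_I add_pos_pos divide_nonneg_pos less_imp_le)
    also have "\<dots> = r * (F (a + s *\<^sub>R x) / s + F (a + t *\<^sub>R y) / t)"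
      using s t by (simp add: r_def distrib_left)
    also have "\<dots> = r * ((F (a + s *\<^sub>R x) - F a) / s + (F (a + t *\<^sub>R y) - F a) / t) + F a"
    proof -
      have "r * (1 / s + 1 / t) = 1"
      proof -
        have "1 / s + 1 / t = (s + t) / (s * t)" using s t by (simp add: field_simps)
        then show ?thesis using s t \<open>s + t \<noteq> 0\<close> by (simp add: r_def)
      qed
      moreover have "r * (F (a + s *\<^sub>R x) / s + F (a + t *\<^sub>R y) / t)
          = r * ((F (a + s *\<^sub>R x) - F a) / s + (F (a + t *\<^sub>R y) - F a) / t) + F a * (r * (1 / s + 1 / t))"
        by (simp add: algebra_simps diff_divide_distrib)
      ultimately show ?thesis by simp
    qed
    finally have "(F (a + r *\<^sub>R (x + y)) - F a) / r \<le> (F (a + s *\<^sub>R x) - F a) / s + (F (a + t *\<^sub>R y) - F a) / t"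
      using r by (simp add: field_simps)
    then show ?thesis using directional_bound_lower[OF r, of "x + y"] by simp
  qed
  then have "?d (x + y) - (F (a + t *\<^sub>R y) - F a) / t \<le> ?d x" if "t > 0" for t
    using that by (intro directional_bound_greatest) (auto simp: algebra_simps)
  then have "?d (x + y) - ?d x \<le> ?d y"
    by (intro directional_bound_greatest) (auto simp: algebra_simps)
  then show "?d (x + y) \<le> ?d x + ?d y" by simp
next
  show "directional_bound F a 0 = 0" by (simp add: directional_bound_def)
next
  fix t :: real and x assume t: "t > 0"
  have "directional_bound F a (t *\<^sub>R x) / t \<le> directional_bound F a x"
  proof (rule directional_bound_greatest)
    fix s :: real assume "s > 0"
    then show "directional_bound F a (t *\<^sub>R x) / t \<le> (F (a + s *\<^sub>R x) - F a) / s"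
      using directional_bound_lower[of "s / t" "t *\<^sub>R x"] t by (simp add: field_simps)
  qed
  then show "directional_bound F a (t *\<^sub>R x) \<le> t * directional_bound F a x"
    using t by (simp add: field_simps)
qed

text \<open>Continuity comes for free: the bound \<open>norm x\<close>, applied to \<open>x\<close>
  and \<open>- x\<close>, controls the absolute value. The step size 1 in the infimum gives the
  subgradient inequality.\<close>

lemma linear_below_directional_bound:
  assumes "linear f" "f \<le> directional_bound F a"
  shows "bounded_linear f" "\<And>x. f x \<le> F (a + x) - F a"
proof -
  have le: "f x \<le> norm x" for x
    using le_funD[OF assms(2), of x] directional_bound_le_norm[of x] by simp
  have "norm (f x) \<le> norm x * 1" for x
    using le[of x] le[of "- x"] linear_neg[OF assms(1), of x] by simp
  then show "bounded_linear f"
    by (intro bounded_linear.intro[OF assms(1)]) (auto simp: bounded_linear_axioms_def intro!: exI[of _ 1])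
  show "f x \<le> F (a + x) - F a" for x
    using le_funD[OF assms(2), of x] directional_bound_le[of x] by simp
qed

lemma subgradients_on_le_directional_bound:
  assumes L: "subspace L" and u: "u \<in> subgradients_on L F a" and x: "x \<in> L"
  shows "u x \<le> directional_bound F a x"
proof (rule directional_bound_greatest)
  fix t :: real assume t: "t > 0"
  have "u (t *\<^sub>R x) = t * u x" "u (t *\<^sub>R x) \<le> F (a + t *\<^sub>R x) - F a"
    using u x subspace_scale[OF L x, of t] unfolding subgradients_on_def dual_on_def by auto
  then show "u x \<le> (F (a + t *\<^sub>R x) - F a) / t"
    using t by (simp add: field_simps)
qed

text \<open>Hahn-Banach with the graph of \<open>u\<close> as cone and the directional bound as
  majorant. The extension is a subgradient on the whole space, which is what attains the supremum in
  \<open>action_on\<close>.\<close>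

lemma subgradient_extends:
  assumes L: "subspace L" and u: "u \<in> subgradients_on L F a"
  shows "\<exists>\<mu> :: 'v \<Rightarrow>\<^sub>L real. restrict (blinfun_apply \<mu>) L = u \<and> (\<forall>x. \<mu> x \<le> F (a + x) - F a)"
proof -
  have u': "u (x + y) = u x + u y" "u (c *\<^sub>R x) = c * u x" if "x \<in> L" "y \<in> L" for x y c
    using u that unfolding subgradients_on_def dual_on_def by auto
  have u0: "u 0 = 0" using u'(2)[of 0 0 0] subspace_0[OF L] by simp
  define G where "G = {(y, u y) | y. y \<in> L}"
  have "\<exists>f. linear f \<and> f \<le> directional_bound F a \<and> (\<forall>(y, c)\<in>G. c \<le> f y)"
    by (rule Hahn_Banach_cone[OF sublinear_directional_bound])
      (use subgradients_on_le_directional_bound[OF L u] u' u0 subspace_0[OF L] subspace_add[OF L]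
        subspace_scale[OF L] in \<open>auto simp: G_def\<close>)
  then obtain f where f: "linear f" "f \<le> directional_bound F a" "\<And>y. y \<in> L \<Longrightarrow> u y \<le> f y"
    unfolding G_def by auto
  have eq: "f y = u y" if "y \<in> L" for y
    using f(3)[OF that] f(3)[OF subspace_neg[OF L that]] linear_neg[OF f(1), of y]
      u'(2)[OF that that, of "-1"] by simp
  have "restrict f L = u"
    using u eq unfolding subgradients_on_def dual_on_def by (auto simp: restrict_def extensional_def)
  moreover note blinfun = bounded_linear_Blinfun_apply[OF linear_below_directional_bound(1)[OF f(1,2)]]
  ultimately show ?thesis
    using linear_below_directional_bound(2)[OF f(1,2)] by (intro exI[of _ "Blinfun f"]) auto
qed

text \<open>Hahn-Banach along the ray of \<open>x\<close> produces a subgradient whose value at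
  \<open>x\<close> is at least the directional bound. By uniqueness its restriction is
  \<open>u\<close>, so the infimum of the quotients is at most \<open>u x\<close>, and some quotient
  lies below \<open>u x + r\<close>.\<close>

lemma unique_subgradient_directional:
  assumes L: "subspace L" and u: "subgradients_on L F a = {u}" and x: "x \<in> L" and r: "r > 0"
  shows "\<exists>t>0. F (a + t *\<^sub>R x) \<le> F a + t * (u x + r)"
proof -
  let ?d = "directional_bound F a"
  define G where "G = {(t *\<^sub>R x, t * ?d x) | t. t \<ge> 0}"
  have "\<exists>f. linear f \<and> f \<le> ?d \<and> (\<forall>(y, c)\<in>G. c \<le> f y)"
  proof (rule Hahn_Banach_cone[OF sublinear_directional_bound])
    show "(0, 0) \<in> G" unfolding G_def by force
    show "(b + c, d + e) \<in> G" if G: "(b, d) \<in> G" "(c, e) \<in> G" for b c d e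
    proof -
      obtain s t where "s \<ge> 0" "t \<ge> 0" "b = s *\<^sub>R x" "d = s * ?d x" "c = t *\<^sub>R x" "e = t * ?d x"
        using G unfolding G_def by auto
      then show ?thesis
        unfolding G_def by (intro CollectI exI[of _ "s + t"]) (auto simp: algebra_simps)
    qed
    show "(t *\<^sub>R b, t * c) \<in> G" if G: "(b, c) \<in> G" and t: "t > 0" for b c t
    proof -
      obtain s where "s \<ge> 0" "b = s *\<^sub>R x" "c = s * ?d x"
        using G unfolding G_def by auto
      then show ?thesis
        using t unfolding G_def by (intro CollectI exI[of _ "t * s"]) auto
    qed
    show "c \<le> ?d b" if "(b, c) \<in> G" for b c
      using that sublinear_scaleR[OF sublinear_directional_bound] unfolding G_def by auto
  qed
  moreover have "(x, ?d x) \<in> G" unfolding G_def by (auto intro!: exI[of _ 1])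
  ultimately obtain f where f: "linear f" "f \<le> ?d" "?d x \<le> f x"
    by fastforce
  note bl = linear_below_directional_bound(1)[OF f(1,2)]
  have "restrict f L \<in> subgradients_on L F a"
  proof -
    obtain B where "\<And>x. norm (f x) \<le> norm x * B" using bounded_linear.bounded[OF bl] by auto
    then have "\<forall>x\<in>L. \<bar>f x\<bar> \<le> B * norm x" by (simp add: mult.commute)
    then show ?thesis
      unfolding subgradients_on_def dual_on_def
      using linear_below_directional_bound(2)[OF f(1,2)] subspace_add[OF L] subspace_scale[OF L]
        linear_add[OF f(1)] linear_scale[OF f(1)]
      by auto
  qed
  then have "?d x \<le> u x" using u f(3) x by auto
  then have "\<not> u x + r \<le> ?d x" using r by simp
  then obtain t where t: "t > 0" "(F (a + t *\<^sub>R x) - F a) / t < u x + r"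
    using directional_bound_greatest[of "u x + r" x] by force
  then show ?thesis by (intro exI[of _ t]) (auto simp: field_simps)
qed

end

section \<open>Subadditive sequences\<close>

lemma subadditive_bound:
  fixes a :: "nat \<Rightarrow> real"
  assumes sub: "\<And>m n. a (m + n) \<le> a m + a n"
  shows "a (q * m + r) \<le> real q * a m + a r"
proof (induction q)
  case (Suc q)
  have "a (Suc q * m + r) \<le> a m + a (q * m + r)"
    using sub[of m "q * m + r"] by (simp add: add.assoc)
  then show ?case using Suc by (simp add: algebra_simps)
qed simp

text \<open>Stated in \<open>ereal\<close> because no lower bound on the quotients is assumed and
  the infimum may be -\<infinity>. Index 0 is left out of the infimum, as \<open>a 0 / 0\<close> is
  0 by convention.\<close>

theorem Fekete:
  fixes a :: "nat \<Rightarrow> real"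
  assumes sub: "\<And>m n. a (m + n) \<le> a m + a n"
  shows "(\<lambda>n. ereal (a n / real n)) \<longlonglongrightarrow> (INF n\<in>{0<..}. ereal (a n / real n))"
proof (rule order_tendstoI)
  fix y assume "y < (INF n\<in>{0<..}. ereal (a n / real n))"
  then have "y < ereal (a n / real n)" if "n > 0" for n
    using that by (intro less_INF_D[where A = "{0<..}" and f = "\<lambda>n. ereal (a n / real n)"]) auto
  then show "\<forall>\<^sub>F n in sequentially. y < ereal (a n / real n)"
    using eventually_gt_at_top[of 0] by (rule eventually_mono[rotated])
next
  fix y assume "(INF n\<in>{0<..}. ereal (a n / real n)) < y"
  then obtain m where m: "m > 0" "ereal (a m / real m) < y"
    by (auto simp: INF_less_iff)
  \<comment> \<open>Division with remainder by \<open>m\<close> costs at most \<open>R\<close> for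
    the value at the remainder and at most \<open>\<bar>a m\<bar>\<close> for replacing
    \<open>q * m\<close> by \<open>n\<close>. Neither depends on \<open>n\<close>, so both vanish
    after division.\<close>
  define R where "R = Max ((\<lambda>r. \<bar>a r\<bar>) ` {..<m})"
  have R: "a r \<le> R" if "r < m" for r
    using that unfolding R_def by (auto intro!: Max_ge_iff[THEN iffD2] bexI[of _ r])
  have bound: "a n / real n \<le> a m / real m + (R + \<bar>a m\<bar>) / real n" if "n > 0" for n
  proof -
    define q r where "q = n div m" and "r = n mod m"
    have r: "r < m" and n: "n = q * m + r" using m by (auto simp: q_def r_def)
    have rn: "real n = real q * real m + real r" using n by simp
    have "a n \<le> real q * a m + R"
      using subadditive_bound[OF sub, of q m r] R[OF r] n by simp
    also have "real q * a m = real n * (a m / real m) - real r / real m * a m"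
      using m by (simp add: rn field_simps)
    also have "\<dots> \<le> real n * (a m / real m) + \<bar>a m\<bar>"
    proof -
      have "\<bar>real r / real m * a m\<bar> \<le> 1 * \<bar>a m\<bar>"
        using r m unfolding abs_mult by (intro mult_right_mono) auto
      then show ?thesis using abs_ge_minus_self[of "real r / real m * a m"] by linarith
    qed
    finally have "a n \<le> real n * (a m / real m) + (R + \<bar>a m\<bar>)" by simp
    then have "a n / real n \<le> (real n * (a m / real m) + (R + \<bar>a m\<bar>)) / real n"
      by (rule divide_right_mono) simp
    then show ?thesis using that by (simp add: add_divide_distrib)
  qed
  have "(\<lambda>n. ereal (a m / real m + (R + \<bar>a m\<bar>) / real n)) \<longlonglongrightarrow> ereal (a m / real m + 0)"
    by (intro tendsto_intros lim_const_over_n)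
  then have "\<forall>\<^sub>F n in sequentially. ereal (a m / real m + (R + \<bar>a m\<bar>) / real n) < y"
    by (rule order_tendstoD) (use m in simp)
  then show "\<forall>\<^sub>F n in sequentially. ereal (a n / real n) < y"
    using eventually_gt_at_top[of 0]
    by eventually_elim (use bound in \<open>auto intro: le_less_trans simp flip: ereal_less_eq(3)\<close>)
qed

section \<open>Local large deviations from the growth of the moment generating function\<close>

text \<open>Chernoff estimates under the tilt \<open>exp (n Y)\<close>. On the slab \<open>Y\<close>
  exceeds \<open>m - r\<close>, which bounds its probability by the total mass \<open>Z 1\<close>.
  Conversely \<open>Z 1\<close> splits into the slab and two tails; raising the exponent to
  \<open>1 + t\<close> dominates the right tail, lowering it to \<open>1 - s\<close> the left
  one.\<close>

lemma tilted_probability_bounds: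
  fixes Y :: "'x \<Rightarrow> real" and m r s t :: real and n :: nat
  assumes M: "prob_space M" and Y: "Y \<in> borel_measurable M" and bdd: "\<And>x. \<bar>Y x\<bar> \<le> B"
    and st: "s > 0" "t > 0"
  defines "Z c \<equiv> \<integral>x. exp (real n * c * Y x) \<partial>M"
    and "A \<equiv> measure M {x \<in> space M. \<bar>Y x - m\<bar> < r}"
  shows "A \<le> exp (- real n * (m - r)) * Z 1"
    and "Z 1 \<le> exp (real n * (m + r)) * A + exp (- real n * t * (m + r)) * Z (1 + t)
           + exp (real n * s * (m - r)) * Z (1 - s)"
proof -
  interpret prob_space M by (rule M)
  have int: "integrable M (\<lambda>x. exp (real n * c * Y x))" for c
  proof (rule integrable_const_bound[where B = "exp (real n * \<bar>c\<bar> * B)"])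
    have "real n * c * Y x \<le> real n * \<bar>c\<bar> * B" for x
    proof -
      have "real n * (c * Y x) \<le> real n * (\<bar>c\<bar> * B)"
        using mult_left_mono[OF bdd[of x], of "\<bar>c\<bar>"] abs_le_D1[of "c * Y x"]
        by (intro mult_left_mono) (auto simp: abs_mult)
      then show ?thesis by (simp add: mult.assoc)
    qed
    then show "AE x in M. norm (exp (real n * c * Y x)) \<le> exp (real n * \<bar>c\<bar> * B)" by simp
  qed (use Y in measurable)
  define S where "S = {x \<in> space M. \<bar>Y x - m\<bar> < r}"
  have S: "S \<in> sets M" unfolding S_def using Y by measurable
  have A: "A = (\<integral>x. indicator S x \<partial>M)" using S by (simp add: A_def S_def)
  have ind: "integrable M (indicator S :: _ \<Rightarrow> real)"
    using S by (intro integrable_real_indicator) (auto simp: emeasure_eq_measure)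
  have "A = (\<integral>x. indicator S x \<partial>M)" by (fact A)
  also have "\<dots> \<le> (\<integral>x. exp (- real n * (m - r)) * exp (real n * 1 * Y x) \<partial>M)"
  proof (rule integral_mono)
    show "indicator S x \<le> exp (- real n * (m - r)) * exp (real n * 1 * Y x)" for x
    proof (cases "x \<in> S")
      case True
      then have "real n * (m - r) \<le> real n * Y x"
        by (intro mult_left_mono) (auto simp: S_def)
      then show ?thesis using True by (simp flip: exp_add)
    qed simp
  qed (use ind int[of 1] in auto)
  finally show "A \<le> exp (- real n * (m - r)) * Z 1"
    using int[of 1] by (simp add: Z_def)
  have "Z 1 \<le> (\<integral>x. exp (real n * (m + r)) * indicator S x
          + exp (- real n * t * (m + r)) * exp (real n * (1 + t) * Y x)
          + exp (real n * s * (m - r)) * exp (real n * (1 - s) * Y x) \<partial>M)"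
    unfolding Z_def
  proof (rule integral_mono)
    fix x assume x: "x \<in> space M"
    consider "x \<in> S" | "Y x \<ge> m + r" | "Y x \<le> m - r" using x unfolding S_def by force
    then show "exp (real n * 1 * Y x) \<le> exp (real n * (m + r)) * indicator S x
          + exp (- real n * t * (m + r)) * exp (real n * (1 + t) * Y x)
          + exp (real n * s * (m - r)) * exp (real n * (1 - s) * Y x)" (is "?l \<le> ?a + ?b + ?c")
    proof cases
      case 1
      then have "real n * Y x \<le> real n * (m + r)"
        by (intro mult_left_mono) (auto simp: S_def)
      then have "?l \<le> ?a" using 1 by simp
      moreover have "0 \<le> ?b" "0 \<le> ?c" by simp_all
      ultimately show ?thesis by linarith
    next
      case 2
      then have "0 \<le> real n * t * (Y x - (m + r))" using st by simp
      then have "?l \<le> ?b" by (simp flip: exp_add add: algebra_simps)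
      moreover have "0 \<le> ?a" "0 \<le> ?c" by simp_all
      ultimately show ?thesis by linarith
    next
      case 3
      then have "0 \<le> real n * s * ((m - r) - Y x)" using st by simp
      then have "?l \<le> ?c" by (simp flip: exp_add add: algebra_simps)
      moreover have "0 \<le> ?a" "0 \<le> ?b" by simp_all
      ultimately show ?thesis by linarith
    qed
  qed (use int int[of 1] ind in auto)
  also have "\<dots> = exp (real n * (m + r)) * A + exp (- real n * t * (m + r)) * Z (1 + t)
           + exp (real n * s * (m - r)) * Z (1 - s)"
    using int ind by (simp add: A Z_def)
  finally show "Z 1 \<le> exp (real n * (m + r)) * A + exp (- real n * t * (m + r)) * Z (1 + t)
           + exp (real n * s * (m - r)) * Z (1 - s)" .
qed

text \<open>Under the tilted measure the tails are exponentially smaller than the total mass,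
  because the slopes of \<Lambda> just beside 1 differ arbitrarily little from \<open>m\<close>. The
  slab thus carries most of the mass, and removing the tilt multiplies by about
  \<open>exp (- n m)\<close>.\<close>

lemma local_large_deviation:
  fixes Y :: "nat \<Rightarrow> 'x \<Rightarrow> real" and M :: "nat \<Rightarrow> 'x measure" and \<Lambda> :: "real \<Rightarrow> real"
  assumes M: "\<forall>\<^sub>F n in sequentially. prob_space (M n) \<and> Y n \<in> borel_measurable (M n)"
    and bdd: "\<And>n x. \<bar>Y n x\<bar> \<le> B"
    and upper: "\<And>c \<kappa>. \<kappa> > 0 \<Longrightarrow> \<forall>\<^sub>F n in sequentially.
      (\<integral>x. exp (real n * c * Y n x) \<partial>M n) \<le> exp (real n * (\<Lambda> c + \<kappa>))"
    and lower: "\<And>\<kappa>. \<kappa> > 0 \<Longrightarrow> \<forall>\<^sub>F n in sequentially.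
      exp (real n * (\<Lambda> 1 - \<kappa>)) \<le> (\<integral>x. exp (real n * 1 * Y n x) \<partial>M n)"
    and right: "\<And>r. r > 0 \<Longrightarrow> \<exists>t>0. \<Lambda> (1 + t) \<le> \<Lambda> 1 + t * (m + r)"
    and left: "\<And>r. r > 0 \<Longrightarrow> \<exists>t>0. \<Lambda> (1 - t) \<le> \<Lambda> 1 - t * (m - r)"
    and \<epsilon>: "\<epsilon> > 0"
  shows "\<forall>\<^sub>F n in sequentially.
    exp (real n * (\<Lambda> 1 - m - \<epsilon>)) < measure (M n) {x \<in> space (M n). \<bar>Y n x - m\<bar> < \<epsilon> / 2} \<and>
    measure (M n) {x \<in> space (M n). \<bar>Y n x - m\<bar> < \<epsilon> / 2} < exp (real n * (\<Lambda> 1 - m + \<epsilon>))"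
proof -
  define r where "r = \<epsilon> / 2"
  \<comment> \<open>The slope slack is half the radius \<open>r\<close>, so the tail exponents
    retain gains of \<open>t * r / 2\<close> and \<open>s * r / 2\<close>.\<close>
  obtain t where t: "t > 0" "\<Lambda> (1 + t) \<le> \<Lambda> 1 + t * (m + r / 2)" using right[of "r / 2"] \<epsilon> by (auto simp: r_def)
  obtain s where s: "s > 0" "\<Lambda> (1 - s) \<le> \<Lambda> 1 - s * (m - r / 2)" using left[of "r / 2"] \<epsilon> by (auto simp: r_def)
  \<comment> \<open>Each gain must cover \<open>3 * \<kappa>\<close>: one for the error of the upper
    bound, two to fall below the lower bound \<open>X\<close> by a factor
    \<open>exp (- \<kappa> n)\<close>. The cap \<open>\<epsilon> / 8\<close> ensures
    \<open>r + 2 * \<kappa> < \<epsilon>\<close> at the end.\<close>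
  define \<kappa> where "\<kappa> = min (\<epsilon> / 8) (min (t * r / 6) (s * r / 6))"
  have \<kappa>: "\<kappa> > 0" "\<kappa> \<le> \<epsilon> / 8" "3 * \<kappa> \<le> t * r / 2" "3 * \<kappa> \<le> s * r / 2"
    using t s \<epsilon> unfolding \<kappa>_def r_def by (auto simp: min_def)
  have "((\<lambda>n. exp (- \<kappa> * real n)) \<longlongrightarrow> 0) sequentially"
    using \<kappa>(1) by real_asymp
  then have small: "\<forall>\<^sub>F n in sequentially. exp (- \<kappa> * real n) < 1 / 4"
    by (rule order_tendstoD) simp
  show ?thesis
    using M upper[OF \<kappa>(1), of 1] upper[OF \<kappa>(1), of "1 + t"] upper[OF \<kappa>(1), of "1 - s"]
      lower[OF \<kappa>(1)] small eventually_gt_at_top[of 0]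
  proof eventually_elim
    case (elim n)
    define Z where "Z c = (\<integral>x. exp (real n * c * Y n x) \<partial>M n)" for c
    define A where "A = measure (M n) {x \<in> space (M n). \<bar>Y n x - m\<bar> < r}"
    define X where "X = exp (real n * (\<Lambda> 1 - \<kappa>))"
    have n: "real n > 0" using elim by simp
    have prob: "prob_space (M n)" "Y n \<in> borel_measurable (M n)" using elim by auto
    note bounds = tilted_probability_bounds[OF prob bdd s(1) t(1), where n = n and m = m and r = r,
        folded Z_def A_def]
    have "A \<le> exp (- real n * (m - r)) * Z 1" by (fact bounds(1))
    also have "\<dots> \<le> exp (- real n * (m - r)) * exp (real n * (\<Lambda> 1 + \<kappa>))"
      using elim by (intro mult_left_mono) (auto simp: Z_def)
    also have "\<dots> = exp (real n * (\<Lambda> 1 - m + r + \<kappa>))"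
      by (simp flip: exp_add add: algebra_simps)
    also have "\<dots> < exp (real n * (\<Lambda> 1 - m + \<epsilon>))"
      using \<kappa>(2) \<epsilon> n by (simp add: r_def)
    finally have up: "A < exp (real n * (\<Lambda> 1 - m + \<epsilon>))" .
    have "exp (- real n * t * (m + r)) * Z (1 + t)
        \<le> exp (- real n * t * (m + r)) * exp (real n * (\<Lambda> (1 + t) + \<kappa>))"
      using elim by (intro mult_left_mono) (auto simp: Z_def)
    also have "\<dots> = exp (real n * (\<Lambda> (1 + t) + \<kappa> - t * (m + r)))"
      by (simp flip: exp_add add: algebra_simps)
    also have "\<dots> \<le> exp (real n * (\<Lambda> 1 - 2 * \<kappa>))"
    proof -
      have "\<Lambda> (1 + t) + \<kappa> - t * (m + r) \<le> \<Lambda> 1 - 2 * \<kappa>"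
        using t(2) \<kappa>(3) by (simp add: algebra_simps)
      then show ?thesis using n by simp
    qed
    also have "\<dots> = X * exp (- \<kappa> * real n)"
      unfolding X_def by (simp flip: exp_add add: algebra_simps)
    also have "\<dots> \<le> X * (1 / 4)" using elim by (intro mult_left_mono) (auto simp: X_def)
    finally have 1: "exp (- real n * t * (m + r)) * Z (1 + t) \<le> X / 4" by simp
    have "exp (real n * s * (m - r)) * Z (1 - s)
        \<le> exp (real n * s * (m - r)) * exp (real n * (\<Lambda> (1 - s) + \<kappa>))"
      using elim by (intro mult_left_mono) (auto simp: Z_def)
    also have "\<dots> = exp (real n * (\<Lambda> (1 - s) + \<kappa> + s * (m - r)))"
      by (simp flip: exp_add add: algebra_simps)
    also have "\<dots> \<le> exp (real n * (\<Lambda> 1 - 2 * \<kappa>))"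
    proof -
      have "\<Lambda> (1 - s) + \<kappa> + s * (m - r) \<le> \<Lambda> 1 - 2 * \<kappa>"
        using s(2) \<kappa>(4) by (simp add: algebra_simps)
      then show ?thesis using n by simp
    qed
    also have "\<dots> = X * exp (- \<kappa> * real n)"
      unfolding X_def by (simp flip: exp_add add: algebra_simps)
    also have "\<dots> \<le> X * (1 / 4)" using elim by (intro mult_left_mono) (auto simp: X_def)
    finally have 2: "exp (real n * s * (m - r)) * Z (1 - s) \<le> X / 4" by simp
    have "X \<le> Z 1" using elim by (simp add: X_def Z_def)
    also note bounds(2)
    \<comment> \<open>Each tail takes at most a quarter of \<open>X\<close>. The remaining constant
      1/2 is next absorbed into \<open>exp (- \<kappa> n)\<close>, leaving a pure
      exponential.\<close>
    finally have "X / 2 \<le> exp (real n * (m + r)) * A" using 1 2 by simp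
    moreover have "X * exp (- \<kappa> * real n) < X / 2"
      using elim mult_strict_left_mono[of "exp (- \<kappa> * real n)" "1 / 2" X] by (simp add: X_def)
    ultimately have "X * exp (- \<kappa> * real n) < exp (real n * (m + r)) * A" by simp
    then have "exp (- real n * (m + r)) * (X * exp (- \<kappa> * real n))
        < exp (- real n * (m + r)) * (exp (real n * (m + r)) * A)"
      by (intro mult_strict_left_mono) auto
    also have "\<dots> = A" by (simp flip: exp_add mult.assoc)
    also have "exp (- real n * (m + r)) * (X * exp (- \<kappa> * real n))
        = exp (real n * (\<Lambda> 1 - m - r - 2 * \<kappa>))"
      unfolding X_def by (simp flip: exp_add add: algebra_simps)
    finally have "exp (real n * (\<Lambda> 1 - m - r - 2 * \<kappa>)) < A" .
    moreover have "exp (real n * (\<Lambda> 1 - m - \<epsilon>)) \<le> exp (real n * (\<Lambda> 1 - m - r - 2 * \<kappa>))"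
      using \<kappa>(2) \<epsilon> n by (simp add: r_def)
    ultimately show ?case using up unfolding A_def r_def by (auto intro: le_less_trans)
  qed
qed

section \<open>Continuous functions on a compact space\<close>

lemma apply_Bcontfun:
  fixes f :: "'x::topological_space \<Rightarrow> 'b::metric_space"
  assumes "compact (UNIV :: 'x set)" "continuous_on UNIV f"
  shows "apply_bcontfun (Bcontfun f) = f"
  using assms compact_imp_bounded[OF compact_continuous_image[OF assms(2,1)]]
  by (intro Bcontfun_inverse) (auto simp: bcontfun_def)

lemma apply_bcontfun_le_norm: "\<bar>apply_bcontfun f x\<bar> \<le> norm f" for f :: "'x::topological_space \<Rightarrow>\<^sub>C real"
  using norm_bounded[of f x] by simp

lemma bounded_linear_apply_bcontfun:
  "bounded_linear (\<lambda>f :: 'x::topological_space \<Rightarrow>\<^sub>C real. apply_bcontfun f x)"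
  by (rule bounded_linear_intro[where K = 1]) (auto simp: apply_bcontfun_le_norm)

text \<open>Compact Hausdorff spaces are normal. Continuous functions therefore detect open sets and
  separate points, which gives continuity and uniqueness of the phase map.\<close>

lemma compact_Urysohn_point:
  fixes y :: "'x::t2_space"
  assumes cpt: "compact (UNIV :: 'x set)" and U: "open U" "y \<in> U"
  shows "\<exists>f :: 'x \<Rightarrow>\<^sub>C real. f y = 1 \<and> (\<forall>z. z \<notin> U \<longrightarrow> f z = 0)"
proof -
  have "compact_space (euclidean :: 'x topology)"
    using cpt by (simp add: compact_space_def)
  then have "normal_space (euclidean :: 'x topology)"
    by (intro compact_Hausdorff_or_regular_imp_normal_space) (auto simp: Hausdorff_space_def separation_t2 disjnt_def)
  moreover have "closedin euclidean (- U)" "closedin euclidean {y}" "disjnt (- U) {y}"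
    using U by (auto simp: disjnt_def)
  ultimately obtain f where f: "continuous_map euclidean (subtopology euclideanreal {0..1::real}) f"
      "f ` (- U) \<subseteq> {0}" "f ` {y} \<subseteq> {1}"
    using Urysohn_lemma[of euclidean "- U" "{y}" 0 1] by auto
  have "continuous_on UNIV f"
    using f(1) by (simp add: continuous_map_in_subtopology)
  then show ?thesis
    using f(2,3) by (intro exI[of _ "Bcontfun f"]) (auto simp: apply_Bcontfun[OF cpt])
qed

section \<open>The embedding of \<open>C(X)\<close> into the algebra\<close>

locale phase_space =
  fixes K C :: "'a::{real_normed_algebra_1, banach} set"
    and \<rho> :: "'a \<Rightarrow> ('x::t2_space \<Rightarrow>\<^sub>C real)"
  assumes positive: "positive_algebra K" and closed: "closed K"
    and phase_sub: "phase_subalgebra K C"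
    and phase_iso: "phase_isomorphism K C \<rho>"
begin

lemma cpt: "compact (UNIV :: 'x set)"
  using phase_iso by (simp add: phase_isomorphism_def)

lemmas apply_Bcontfun = apply_Bcontfun[OF cpt]

lemma C_subspace: "subspace C" and C_1: "1 \<in> C"
  and C_mult: "f \<in> C \<Longrightarrow> g \<in> C \<Longrightarrow> f * g \<in> C"
  using phase_sub by (auto simp: phase_subalgebra_def)

lemmas C_intros = C_1 C_mult subspace_add[OF C_subspace] subspace_diff[OF C_subspace] subspace_scale[OF C_subspace]

lemma \<rho>_add: "f \<in> C \<Longrightarrow> g \<in> C \<Longrightarrow> \<rho> (f + g) = \<rho> f + \<rho> g"
  and \<rho>_mult: "f \<in> C \<Longrightarrow> g \<in> C \<Longrightarrow> \<rho> (f * g) x = \<rho> f x * \<rho> g x"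
  and \<rho>_scaleR: "f \<in> C \<Longrightarrow> \<rho> (c *\<^sub>R f) = c *\<^sub>R \<rho> f"
  and \<rho>_1: "\<rho> 1 x = 1"
  and mem_K_iff: "f \<in> C \<Longrightarrow> f \<in> K \<longleftrightarrow> (\<forall>x. 0 \<le> \<rho> f x)"
  and \<rho>_inj: "inj_on \<rho> C"
  and \<rho>_dense: "closure (\<rho> ` C) = UNIV"
  using phase_iso by (auto simp: phase_isomorphism_def)

lemma \<rho>_diff: "f \<in> C \<Longrightarrow> g \<in> C \<Longrightarrow> \<rho> (f - g) = \<rho> f - \<rho> g"
  using \<rho>_add[of f "- 1 *\<^sub>R g"] \<rho>_scaleR[of g "- 1"] C_intros(5)[of g "- 1"] by simp

lemma dense_induct:
  assumes "closed {f. P f}" "\<And>f. f \<in> C \<Longrightarrow> P (\<rho> f)"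
  shows "P f"
  using closure_minimal[of "\<rho> ` C" "{f. P f}"] assms \<rho>_dense by auto

lemma K_1: "1 \<in> K"
  and K_mult: "u \<in> K \<Longrightarrow> v \<in> K \<Longrightarrow> u * v \<in> K"
  and norm_mono: "u \<in> K \<Longrightarrow> v - u \<in> K \<Longrightarrow> norm u \<le> norm v"
  using positive by (force simp: positive_algebra_def)+

lemma K_power: "u \<in> K \<Longrightarrow> u ^ n \<in> K"
  by (induction n) (auto simp: K_1 K_mult)

text \<open>Norm monotonicity applies only to positive elements, so \<open>f\<close> is shifted by
  the constant \<open>t\<close>: both \<open>t - f\<close> and \<open>t + f\<close> lie in the cone
  and add up to \<open>2 t\<close>, whence \<open>norm (t - f) \<le> 2 t\<close>. Undoing the shift
  adds another \<open>t\<close>, hence the 3.\<close>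

lemma norm_le_\<rho>:
  assumes f: "f \<in> C"
  shows "norm f \<le> 3 * norm (\<rho> f)"
proof -
  define t where "t = norm (\<rho> f)"
  have "t *\<^sub>R 1 - f \<in> K" "t *\<^sub>R 1 + f \<in> K"
    using apply_bcontfun_le_norm[of "\<rho> f"]
    by (auto simp: mem_K_iff C_intros f \<rho>_diff \<rho>_add \<rho>_scaleR \<rho>_1 t_def abs_le_iff minus_le_iff
        intro: add_nonneg_nonneg) (smt (verit))
  then have "norm (t *\<^sub>R 1 - f) \<le> norm (t *\<^sub>R 1 + t *\<^sub>R (1 :: 'a))"
    by (intro norm_mono) simp_all
  also have "\<dots> \<le> 2 * t" using norm_triangle_ineq[of "t *\<^sub>R (1 :: 'a)" "t *\<^sub>R 1"] by (simp add: t_def)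
  finally have "norm (t *\<^sub>R 1 - f) \<le> 2 * t" .
  moreover have "norm f \<le> norm (t *\<^sub>R (1 :: 'a)) + norm (t *\<^sub>R 1 - f)"
    using norm_triangle_ineq4[of "t *\<^sub>R 1" "t *\<^sub>R 1 - f"] by simp
  ultimately show ?thesis by (simp add: t_def)
qed

text \<open>The inverse of \<rho> is Lipschitz on a dense set and the algebra is complete, so it
  extends to the closure.\<close>

lemma embedding_exists: "\<exists>j. 3-lipschitz_on UNIV j \<and> (\<forall>f\<in>C. j (\<rho> f) = f)"
proof -
  have "3-lipschitz_on (\<rho> ` C) (inv_into C \<rho>)"
  proof (rule lipschitz_onI)
    fix x y assume "x \<in> \<rho> ` C" "y \<in> \<rho> ` C"
    then obtain f g where "f \<in> C" "g \<in> C" "x = \<rho> f" "y = \<rho> g" by auto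
    then show "dist (inv_into C \<rho> x) (inv_into C \<rho> y) \<le> 3 * dist x y"
      using norm_le_\<rho>[of "f - g"] by (simp add: dist_norm inv_into_f_f[OF \<rho>_inj] C_intros \<rho>_diff)
  qed simp
  from lipschitz_extend_closure[OF this] show ?thesis
    by (auto simp: \<rho>_dense inv_into_f_f[OF \<rho>_inj])
qed

abbreviation j :: "('x \<Rightarrow>\<^sub>C real) \<Rightarrow> 'a" where "j \<equiv> phase_embedding C \<rho>"

text \<open>The description defining \<open>j\<close> denotes the Lipschitz extension, since
  continuous maps that agree on a dense set coincide.\<close>

lemma j_lipschitz: "3-lipschitz_on UNIV j" and j_\<rho>: "f \<in> C \<Longrightarrow> j (\<rho> f) = f"
proof -
  obtain k where k: "3-lipschitz_on UNIV k" "\<forall>f\<in>C. k (\<rho> f) = f" using embedding_exists by blast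
  have "j = k"
    unfolding phase_embedding_def
  proof (rule the_equality)
    show "continuous_on UNIV k \<and> (\<forall>f\<in>C. k (\<rho> f) = f)"
      using k lipschitz_on_continuous_on by blast
    fix l assume l: "continuous_on UNIV l \<and> (\<forall>f\<in>C. l (\<rho> f) = f)"
    have "l f = k f" for f
      by (rule dense_induct[of "\<lambda>f. l f = k f"])
        (use k l lipschitz_on_continuous_on in \<open>auto intro!: closed_Collect_eq\<close>)
    then show "l = k" ..
  qed
  then show "3-lipschitz_on UNIV j" "f \<in> C \<Longrightarrow> j (\<rho> f) = f" using k by auto
qed

lemma j_continuous: "continuous_on S j"
  using lipschitz_on_continuous_on[OF j_lipschitz] by (rule continuous_on_subset) simp

lemma j_continuous_comp: "continuous_on S f \<Longrightarrow> continuous_on S (\<lambda>x. j (f x))"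
  using continuous_on_compose2[OF j_continuous[of UNIV]] by auto

lemma j_add: "j (f + g) = j f + j g"
proof (rule dense_induct[of "\<lambda>f. j (f + g) = j f + j g"])
  show "closed {f. j (f + g) = j f + j g}"
    by (intro closed_Collect_eq j_continuous_comp continuous_intros j_continuous)
  show "j (\<rho> f + g) = j (\<rho> f) + j g" if f: "f \<in> C" for f
    by (rule dense_induct[of "\<lambda>g. j (\<rho> f + g) = j (\<rho> f) + j g"])
      (intro closed_Collect_eq j_continuous_comp continuous_intros j_continuous,
        use f in \<open>auto simp: j_\<rho> C_intros simp flip: \<rho>_add\<close>)
qed

lemma j_scaleR: "j (c *\<^sub>R f) = c *\<^sub>R j f"
  by (rule dense_induct[of "\<lambda>f. j (c *\<^sub>R f) = c *\<^sub>R j f"])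
      (intro closed_Collect_eq j_continuous_comp continuous_intros j_continuous,
        auto simp: j_\<rho> C_intros simp flip: \<rho>_scaleR)

lemma j_diff: "j (f - g) = j f - j g"
  using j_add[of f "- 1 *\<^sub>R g"] j_scaleR[of "- 1" g] by simp

text \<open>The local product \<open>mul\<close> is continuous in each argument separately, which
  suffices for two successive density arguments reducing the claim to \<open>C\<close>.\<close>

lemma j_mult:
  fixes f g h :: "'x \<Rightarrow>\<^sub>C real"
  assumes h: "\<And>x. h x = f x * g x"
  shows "j h = j f * j g"
proof -
  define mul where "mul f g = Bcontfun (\<lambda>x. apply_bcontfun f x * apply_bcontfun g x)"
    for f g :: "'x \<Rightarrow>\<^sub>C real"
  have mul: "apply_bcontfun (mul f g) x = f x * g x" for f g x
    unfolding mul_def by (subst apply_Bcontfun) (auto intro!: continuous_intros)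
  have "bounded_linear (\<lambda>f. mul f g)" for g
  proof (rule bounded_linear_intro)
    show "norm (mul f g) \<le> norm f * norm g" for f
      by (rule norm_bound) (auto simp: mul abs_mult intro!: mult_mono apply_bcontfun_le_norm)
  qed (auto intro!: bcontfun_eqI simp: mul algebra_simps)
  then have cont: "continuous_on S (\<lambda>f. mul f g)" "continuous_on S (\<lambda>f. mul g f)" for g S
  proof -
    have "mul g = (\<lambda>f. mul f g)"
      by (auto intro!: bcontfun_eqI simp: mul mult.commute)
    then show "continuous_on S (\<lambda>f. mul f g)" "continuous_on S (\<lambda>f. mul g f)"
      using \<open>\<And>g. bounded_linear (\<lambda>f. mul f g)\<close>[of g] by (simp_all add: linear_continuous_on)
  qed
  have *: "mul (\<rho> f) (\<rho> g) = \<rho> (f * g)" if "f \<in> C" "g \<in> C" for f g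
    using that by (intro bcontfun_eqI) (simp add: mul \<rho>_mult)
  have "j (mul f g) = j f * j g"
  proof (rule dense_induct[of "\<lambda>f. j (mul f g) = j f * j g"])
    show "closed {f. j (mul f g) = j f * j g}"
      by (intro closed_Collect_eq j_continuous_comp continuous_intros j_continuous cont)
    show "j (mul (\<rho> f) g) = j (\<rho> f) * j g" if f: "f \<in> C" for f
      by (rule dense_induct[of "\<lambda>g. j (mul (\<rho> f) g) = j (\<rho> f) * j g"])
        (intro closed_Collect_eq j_continuous_comp continuous_intros j_continuous cont,
          use f in \<open>auto simp: j_\<rho> C_intros *\<close>)
  qed
  moreover have "h = mul f g" by (rule bcontfun_eqI) (simp add: mul h)
  ultimately show ?thesis by simp
qed

lemma j_1: "(\<And>x. apply_bcontfun f x = 1) \<Longrightarrow> j f = 1"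
  using j_\<rho>[OF C_1] \<rho>_1 by (metis bcontfun_eqI)

lemma j_positive:
  fixes f :: "'x \<Rightarrow>\<^sub>C real"
  assumes f: "\<And>x. 0 \<le> f x"
  shows "j f \<in> K"
proof -
  have "j f \<in> closure K"
    unfolding closure_approachable
  proof (intro allI impI)
    fix e :: real assume e: "e > 0"
    have "f \<in> closure (\<rho> ` C)" by (simp add: \<rho>_dense)
    \<comment> \<open>Adding the constant \<open>e / 5\<close> makes the approximant positive. The
      shift moves it by \<open>e / 5\<close> and the embedding enlarges the approximation error at
      most threefold, so the total stays below \<open>4 * e / 5\<close>.\<close>
    then obtain c where c: "c \<in> C" "dist (\<rho> c) f < e / 5"
      using e unfolding closure_approachable by (metis divide_pos_pos imageE zero_less_numeral)
    have "\<rho> c x + e / 5 \<ge> 0" for x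
      using dist_bounded[of "\<rho> c" x f] c(2) f[of x] by (auto simp: dist_real_def abs_le_iff)
    then have "c + (e / 5) *\<^sub>R 1 \<in> K"
      using c(1) by (simp add: mem_K_iff C_intros \<rho>_add \<rho>_scaleR \<rho>_1)
    moreover have "dist (c + (e / 5) *\<^sub>R 1) (j f) < e"
    proof -
      have "dist (c + (e / 5) *\<^sub>R 1) (j f) \<le> dist (c + (e / 5) *\<^sub>R 1) c + dist (j (\<rho> c)) (j f)"
        using c(1) by (metis dist_triangle j_\<rho>)
      also have "\<dots> \<le> e / 5 + 3 * dist (\<rho> c) f"
        using e lipschitz_onD[OF j_lipschitz, of "\<rho> c" f] by (simp add: dist_norm)
      finally show ?thesis using c(2) e by simp
    qed
    ultimately show "\<exists>y\<in>K. dist y (j f) < e" by blast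
  qed
  then show ?thesis using closed by simp
qed

text \<open>The bridge from pointwise estimates on \<open>X\<close> to norms in the algebra; the
  Lipschitz bound and the convexity of the spectral potential both rest on it.\<close>

lemma norm_j_mult_mono:
  fixes f g :: "'x \<Rightarrow>\<^sub>C real"
  assumes "\<And>x. 0 \<le> f x" "\<And>x. f x \<le> g x" "b \<in> K"
  shows "norm (j f * b) \<le> norm (j g * b)"
proof (rule norm_mono)
  show "j f * b \<in> K" using assms by (intro K_mult j_positive)
  have "j (g - f) * b \<in> K" using assms by (intro K_mult j_positive) auto
  then show "j g * b - j f * b \<in> K" by (simp add: j_diff algebra_simps)
qed

text \<open>Supplies the points of the phase map. As \<open>C\<close> is merely dense, a nowhere
  vanishing element need not be invertible in it, so the contradiction comes from positivity of
  \<omega>.\<close>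

lemma character_is_evaluation:
  fixes \<omega> :: "'a \<Rightarrow> real"
  assumes add: "\<And>f g. f \<in> C \<Longrightarrow> g \<in> C \<Longrightarrow> \<omega> (f + g) = \<omega> f + \<omega> g"
    and mult: "\<And>f g. f \<in> C \<Longrightarrow> g \<in> C \<Longrightarrow> \<omega> (f * g) = \<omega> f * \<omega> g"
    and scale: "\<And>f c. f \<in> C \<Longrightarrow> \<omega> (c *\<^sub>R f) = c * \<omega> f"
    and one: "\<omega> 1 = 1"
    and pos: "\<And>f. f \<in> C \<Longrightarrow> f \<in> K \<Longrightarrow> 0 \<le> \<omega> f"
  shows "\<exists>y. \<forall>f\<in>C. \<rho> f y = \<omega> f"
proof (rule ccontr)
  assume "\<nexists>y. \<forall>f\<in>C. \<rho> f y = \<omega> f"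
  then have "\<forall>y. \<exists>f. f \<in> C \<and> \<rho> f y \<noteq> \<omega> f" by blast
  then obtain F where F: "\<And>y. F y \<in> C" "\<And>y. \<rho> (F y) y \<noteq> \<omega> (F y)" by metis
  have diff: "\<omega> (f - c *\<^sub>R 1) = \<omega> f - c" if "f \<in> C" for f c
    using add[OF that, of "- c *\<^sub>R 1"] scale[OF C_1, of "- c"] one C_intros(5)[OF C_1, of "- c"] by simp
  define good where "good V \<longleftrightarrow> (\<exists>g\<in>C. \<omega> g = 0 \<and> (\<forall>z. 0 \<le> \<rho> g z) \<and> (\<forall>z\<in>V. 0 < \<rho> g z))" for V
  define V where "V y = {z. \<rho> (F y) z \<noteq> \<omega> (F y)}" for y
  \<comment> \<open>Squares in the kernel of \<open>\<omega>\<close> add up, by compactness, to a strictly positive element of the kernel.\<close>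
  have good_V: "good (V y)" for y
  proof -
    define g where "g = (F y - \<omega> (F y) *\<^sub>R 1) * (F y - \<omega> (F y) *\<^sub>R 1)"
    have "\<rho> g z = (\<rho> (F y) z - \<omega> (F y))\<^sup>2" for z
      by (simp add: g_def \<rho>_mult C_intros F \<rho>_diff \<rho>_scaleR \<rho>_1 power2_eq_square)
    moreover have "\<omega> g = 0" "g \<in> C"
      by (simp_all add: g_def mult C_intros F diff)
    ultimately show ?thesis unfolding good_def V_def by (intro bexI[of _ g]) auto
  qed
  have "good (\<Union>y\<in>D. V y)" if "finite D" for D
    using that
  proof (induction D)
    case empty
    have "\<omega> 0 = 0" "\<rho> 0 x = 0" for x
      using scale[OF C_1, of 0] \<rho>_scaleR[OF C_1, of 0] by auto
    then show ?case unfolding good_def by (intro bexI[of _ 0]) (auto simp: subspace_0[OF C_subspace])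
  next
    case (insert y D)
    obtain g where g: "g \<in> C" "\<omega> g = 0" "\<forall>z. 0 \<le> \<rho> g z" "\<forall>z\<in>V y. 0 < \<rho> g z"
      using good_V[of y] unfolding good_def by blast
    obtain h where h: "h \<in> C" "\<omega> h = 0" "\<forall>z. 0 \<le> \<rho> h z" "\<forall>z\<in>(\<Union>y\<in>D. V y). 0 < \<rho> h z"
      using insert.IH unfolding good_def by blast
    show ?case
      unfolding good_def
      by (intro bexI[of _ "g + h"])
        (use g h in \<open>auto simp: C_intros \<rho>_add add intro: add_pos_nonneg add_nonneg_pos\<close>)
  qed
  moreover obtain D where "finite D" "UNIV \<subseteq> (\<Union>y\<in>D. V y)"
  proof (rule compactE_image[OF cpt])
    show "open (V y)" for y
      unfolding V_def by (intro open_Collect_neq continuous_intros) auto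
    show "UNIV \<subseteq> (\<Union>y\<in>UNIV. V y)" using F(2) by (auto simp: V_def)
  qed auto
  ultimately have "good UNIV" by (metis top.extremum_uniqueI)
  then obtain g where g: "g \<in> C" "\<omega> g = 0" "\<And>z. 0 < \<rho> g z" unfolding good_def by auto
  \<comment> \<open>By compactness the minimum of \<open>g\<close> is attained and positive.
    Subtracting it leaves an element of the cone on which \<omega> is negative.\<close>
  obtain z where z: "\<And>x. \<rho> g z \<le> \<rho> g x"
    using continuous_attains_inf[OF cpt, of "\<rho> g"] by auto
  have "g - \<rho> g z *\<^sub>R 1 \<in> K"
    using z by (simp add: mem_K_iff C_intros g \<rho>_diff \<rho>_scaleR \<rho>_1)
  then have "0 \<le> \<omega> (g - \<rho> g z *\<^sub>R 1)" by (intro pos C_intros g)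
  then show False using g(3)[of z] by (simp add: diff g)
qed

end

section \<open>Covariant positive flows\<close>

locale covariant_flow =
  fixes K C :: "'a::{real_normed_algebra_1, banach} set" and E :: 'a and \<alpha>s :: "'a \<Rightarrow> 'a"
    and \<rho> :: "'a \<Rightarrow> ('x::t2_space \<Rightarrow>\<^sub>C real)"
  assumes flow: "covariant_positive_flow K C E \<alpha>s"
    and iso: "phase_isomorphism K C \<rho>"
begin

sublocale phase_space K C \<rho>
  using flow iso by unfold_locales (auto simp: covariant_positive_flow_def)

lemma E_K: "E \<in> K"
  and \<alpha>s_C: "f \<in> C \<Longrightarrow> \<alpha>s f \<in> C"
  and \<alpha>s_add: "f \<in> C \<Longrightarrow> g \<in> C \<Longrightarrow> \<alpha>s (f + g) = \<alpha>s f + \<alpha>s g"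
  and \<alpha>s_mult: "f \<in> C \<Longrightarrow> g \<in> C \<Longrightarrow> \<alpha>s (f * g) = \<alpha>s f * \<alpha>s g"
  and \<alpha>s_scaleR: "f \<in> C \<Longrightarrow> \<alpha>s (c *\<^sub>R f) = c *\<^sub>R \<alpha>s f"
  and \<alpha>s_1: "\<alpha>s 1 = 1"
  and \<alpha>s_pos: "f \<in> C \<Longrightarrow> f \<in> K \<Longrightarrow> \<alpha>s f \<in> K"
  and E_comm: "f \<in> C \<Longrightarrow> E * f = \<alpha>s f * E"
  using flow by (auto simp: covariant_positive_flow_def)

abbreviation \<alpha> :: "'x \<Rightarrow> 'x" where "\<alpha> \<equiv> phase_map C \<rho> \<alpha>s"

text \<open>For fixed \<open>x\<close>, the map sending \<open>f\<close> to
  \<open>\<rho> (\<alpha>s f) x\<close> is a positive unital character of \<open>C\<close>, hence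
  evaluation at a point \<open>a x\<close>. Continuity of \<open>a\<close> follows because
  \<open>X\<close> carries the topology generated by its continuous functions.\<close>

lemma phase_map_exists:
  "\<exists>a :: 'x \<Rightarrow> 'x. continuous_on UNIV a \<and> (\<forall>f\<in>C. \<forall>x. \<rho> (\<alpha>s f) x = \<rho> f (a x))"
proof -
  have "\<exists>y. \<forall>f\<in>C. \<rho> f y = \<rho> (\<alpha>s f) x" for x
  proof (rule character_is_evaluation)
    show "0 \<le> \<rho> (\<alpha>s f) x" if "f \<in> C" "f \<in> K" for f
      using \<alpha>s_pos[OF that] mem_K_iff[OF \<alpha>s_C[OF that(1)]] by blast
  qed (simp_all add: \<alpha>s_add \<alpha>s_mult \<alpha>s_scaleR \<alpha>s_1 \<alpha>s_C \<rho>_add \<rho>_mult \<rho>_scaleR \<rho>_1)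
  then obtain a where a: "\<And>x f. f \<in> C \<Longrightarrow> \<rho> f (a x) = \<rho> (\<alpha>s f) x" by metis
  \<comment> \<open>Uniform convergence survives composition with any map \<open>a\<close>, so
    continuity of \<open>f\<close> after \<open>a\<close> passes from the dense image of
    \<open>C\<close> to all \<open>f\<close>, before \<open>a\<close> itself is known to be
    continuous.\<close>
  have comp: "continuous_on UNIV (\<lambda>x. f (a x))" for f :: "'x \<Rightarrow>\<^sub>C real"
  proof (rule dense_induct[of "\<lambda>f. continuous_on UNIV (\<lambda>x. apply_bcontfun f (a x))"])
    show "closed {f :: 'x \<Rightarrow>\<^sub>C real. continuous_on UNIV (\<lambda>x. apply_bcontfun f (a x))}"
      unfolding closed_sequential_limits
    proof (intro allI impI, elim conjE)
      fix F :: "nat \<Rightarrow> 'x \<Rightarrow>\<^sub>C real" and l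
      assume F: "\<forall>n. F n \<in> {f. continuous_on UNIV (\<lambda>x. apply_bcontfun f (a x))}" "F \<longlonglongrightarrow> l"
      have "uniform_limit UNIV (\<lambda>n x. F n (a x)) (\<lambda>x. l (a x)) sequentially"
        using tendsto_bcontfun_uniform_limit[OF F(2)] by (rule uniform_limit_compose') auto
      then have "continuous_on UNIV (\<lambda>x. l (a x))"
        by (rule uniform_limit_theorem[rotated]) (use F(1) in auto)
      then show "l \<in> {f. continuous_on UNIV (\<lambda>x. apply_bcontfun f (a x))}" by simp
    qed
  qed (simp add: a)
  have "continuous_on UNIV a"
  proof (subst continuous_on_open_vimage[OF open_UNIV], intro allI impI)
    fix U :: "'x set" assume U: "open U"
    show "open (a -` U \<inter> UNIV)"
    proof (subst open_subopen, intro ballI)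
      fix x assume "x \<in> a -` U \<inter> UNIV"
      then obtain f :: "'x \<Rightarrow>\<^sub>C real" where f: "f (a x) = 1" "\<And>z. z \<notin> U \<Longrightarrow> f z = 0"
        using compact_Urysohn_point[OF cpt U, of "a x"] by auto
      have "open {z. 0 < f (a z)}"
        by (intro open_Collect_less continuous_intros comp)
      moreover have "z \<in> U" if "0 < f z" for z
        using f(2)[of z] that by fastforce
      ultimately show "\<exists>T. open T \<and> x \<in> T \<and> T \<subseteq> a -` U \<inter> UNIV"
        using f(1) by (intro exI[of _ "{z. 0 < f (a z)}"]) auto
    qed
  qed
  then show ?thesis using a by auto
qed

lemma \<alpha>_continuous: "continuous_on UNIV \<alpha>" and \<rho>_\<alpha>s: "f \<in> C \<Longrightarrow> \<rho> (\<alpha>s f) x = \<rho> f (\<alpha> x)"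
proof -
  obtain a where a: "continuous_on UNIV a" "\<And>f x. f \<in> C \<Longrightarrow> \<rho> (\<alpha>s f) x = \<rho> f (a x)"
    using phase_map_exists by blast
  have "\<alpha> = a"
    unfolding phase_map_def
  proof (rule the_equality)
    fix b assume b: "continuous_on UNIV b \<and> (\<forall>f\<in>C. \<forall>x. \<rho> (\<alpha>s f) x = \<rho> f (b x))"
    have eq: "f (b x) = f (a x)" for f :: "'x \<Rightarrow>\<^sub>C real" and x
      by (rule dense_induct[of "\<lambda>f. apply_bcontfun f (b x) = apply_bcontfun f (a x)"])
        (use a b in \<open>auto intro!: closed_Collect_eq linear_continuous_on bounded_linear_apply_bcontfun\<close>)
    have "b x = a x" for x
    proof (rule ccontr)
      assume "b x \<noteq> a x"
      then obtain f :: "'x \<Rightarrow>\<^sub>C real" where "f (b x) = 1" "f (a x) = 0"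
        using compact_Urysohn_point[OF cpt, of "- {a x}" "b x"] by auto
      then show False using eq[of f x] by simp
    qed
    then show "b = a" ..
  qed (use a in auto)
  then show "continuous_on UNIV \<alpha>" "f \<in> C \<Longrightarrow> \<rho> (\<alpha>s f) x = \<rho> f (\<alpha> x)" using a by auto
qed

lemma iterate_continuous: "continuous_on UNIV (\<lambda>x. (\<alpha> ^^ i) x)"
proof (induction i)
  case (Suc i)
  show ?case using continuous_on_compose2[OF \<alpha>_continuous Suc] by simp
qed simp

lemma E_j:
  fixes f g :: "'x \<Rightarrow>\<^sub>C real"
  assumes g: "\<And>x. g x = f (\<alpha> x)"
  shows "E * j f = j g * E"
proof -
  define com where "com f = Bcontfun (\<lambda>x. apply_bcontfun f (\<alpha> x))" for f :: "'x \<Rightarrow>\<^sub>C real"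
  have com: "apply_bcontfun (com f) x = f (\<alpha> x)" for f x
    unfolding com_def
    by (subst apply_Bcontfun) (auto intro!: continuous_on_compose2[OF _ \<alpha>_continuous, of UNIV])
  have "bounded_linear com"
  proof (rule bounded_linear_intro)
    show "norm (com f) \<le> norm f * 1" for f
      using apply_bcontfun_le_norm by (intro norm_bound) (auto simp: com)
  qed (auto intro!: bcontfun_eqI simp: com)
  then have cont: "continuous_on S com" for S by (rule linear_continuous_on)
  have *: "com (\<rho> f) = \<rho> (\<alpha>s f)" if "f \<in> C" for f
    using that by (intro bcontfun_eqI) (simp add: com \<rho>_\<alpha>s)
  have "E * j f = j (com f) * E"
    by (rule dense_induct[of "\<lambda>f. E * j f = j (com f) * E"])
      (intro closed_Collect_eq j_continuous_comp continuous_intros j_continuous cont,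
        auto simp: j_\<rho> * \<alpha>s_C E_comm)
  moreover have "g = com f" by (rule bcontfun_eqI) (simp add: com g)
  ultimately show ?thesis by simp
qed

section \<open>Birkhoff sums and powers of the weighted element\<close>

definition birkhoff :: "('x \<Rightarrow>\<^sub>C real) \<Rightarrow> nat \<Rightarrow> 'x \<Rightarrow> real" where
  "birkhoff \<eta> n x = (\<Sum>i<n. \<eta> ((\<alpha> ^^ i) x))"

lemma birkhoff_continuous: "continuous_on UNIV (birkhoff \<eta> n)"
proof -
  have "continuous_on UNIV (\<lambda>x. \<Sum>i<n. \<eta> ((\<alpha> ^^ i) x))"
    by (intro continuous_on_sum continuous_on_compose2[OF _ iterate_continuous, of UNIV]) auto
  then show ?thesis by (simp add: birkhoff_def[abs_def])
qed

lemma birkhoff_add: "birkhoff (\<eta> + \<xi>) n x = birkhoff \<eta> n x + birkhoff \<xi> n x"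
  and birkhoff_diff: "birkhoff (\<eta> - \<xi>) n x = birkhoff \<eta> n x - birkhoff \<xi> n x"
  and birkhoff_scaleR: "birkhoff (c *\<^sub>R \<eta>) n x = c * birkhoff \<eta> n x"
  by (simp_all add: birkhoff_def sum.distrib sum_subtractf sum_distrib_left)

lemma birkhoff_bound: "\<bar>birkhoff \<eta> n x\<bar> \<le> real n * norm \<eta>"
proof -
  have "\<bar>birkhoff \<eta> n x\<bar> \<le> (\<Sum>i<n. \<bar>\<eta> ((\<alpha> ^^ i) x)\<bar>)"
    unfolding birkhoff_def by (rule sum_abs)
  also have "\<dots> \<le> (\<Sum>i<n. norm \<eta>)" by (intro sum_mono apply_bcontfun_le_norm)
  finally show ?thesis by simp
qed

definition exp_birkhoff :: "('x \<Rightarrow>\<^sub>C real) \<Rightarrow> nat \<Rightarrow> 'x \<Rightarrow>\<^sub>C real" where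
  "exp_birkhoff \<eta> n = Bcontfun (\<lambda>x. exp (birkhoff \<eta> n x))"

lemma exp_birkhoff_apply: "apply_bcontfun (exp_birkhoff \<eta> n) x = exp (birkhoff \<eta> n x)"
  unfolding exp_birkhoff_def
  by (subst apply_Bcontfun) (auto intro!: continuous_intros birkhoff_continuous)

abbreviation W :: "('x \<Rightarrow>\<^sub>C real) \<Rightarrow> nat \<Rightarrow> 'a" where "W \<eta> n \<equiv> weighted j E \<eta> ^ n"

text \<open>Moving \<open>E\<close> past the exponential of a Birkhoff sum composes that sum with
  \<alpha>, raising every index by one; the new factor \<open>exp (\<eta> x)\<close> then supplies
  the term of index 0.\<close>

lemma weighted_power: "W \<eta> n = j (exp_birkhoff \<eta> n) * E ^ n"
proof (induction n)
  case 0
  show ?case by (simp add: j_1 exp_birkhoff_apply birkhoff_def)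
next
  case (Suc n)
  define g where "g = Bcontfun (\<lambda>x. exp (birkhoff \<eta> n (\<alpha> x)))"
  have g: "apply_bcontfun g x = exp (birkhoff \<eta> n (\<alpha> x))" for x
    unfolding g_def by (subst apply_Bcontfun)
      (auto intro!: continuous_intros continuous_on_compose2[OF birkhoff_continuous \<alpha>_continuous])
  have e: "apply_bcontfun (Bcontfun (\<lambda>x. exp (\<eta> x))) x = exp (\<eta> x)" for x
    by (subst apply_Bcontfun) (auto intro!: continuous_intros)
  have "W \<eta> (Suc n) = weighted j E \<eta> * W \<eta> n" by simp
  also have "\<dots> = j (Bcontfun (\<lambda>x. exp (\<eta> x))) * (E * j (exp_birkhoff \<eta> n)) * E ^ n"
    unfolding Suc by (simp add: weighted_def mult.assoc)
  also have "E * j (exp_birkhoff \<eta> n) = j g * E"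
    by (rule E_j) (simp add: g exp_birkhoff_apply)
  also have "j (Bcontfun (\<lambda>x. exp (\<eta> x))) * (j g * E) * E ^ n
      = (j (Bcontfun (\<lambda>x. exp (\<eta> x))) * j g) * E ^ Suc n"
    by (simp add: mult.assoc)
  also have "j (Bcontfun (\<lambda>x. exp (\<eta> x))) * j g = j (exp_birkhoff \<eta> (Suc n))"
    by (rule j_mult[symmetric])
      (simp add: g e exp_birkhoff_apply birkhoff_def sum.lessThan_Suc_shift funpow_swap1 exp_add
        del: sum.lessThan_Suc)
  finally show ?case .
qed

lemma weighted_power_shift: "W (\<xi> + \<eta>) n = j (exp_birkhoff \<eta> n) * W \<xi> n"
proof -
  have "j (exp_birkhoff (\<xi> + \<eta>) n) = j (exp_birkhoff \<eta> n) * j (exp_birkhoff \<xi> n)"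
    by (rule j_mult) (simp add: exp_birkhoff_apply birkhoff_add exp_add mult.commute)
  then show ?thesis by (simp add: weighted_power mult.assoc)
qed

end

section \<open>The spectral potential\<close>

lemma tendsto_scaled_eln:
  assumes lim: "(\<lambda>n. ereal (1 / real n) * eln (a n)) \<longlonglongrightarrow> ereal l"
  shows "\<forall>\<^sub>F n in sequentially. a n > 0"
    and "\<kappa> > 0 \<Longrightarrow> \<forall>\<^sub>F n in sequentially. exp (real n * (l - \<kappa>)) \<le> a n"
    and "\<kappa> > 0 \<Longrightarrow> \<forall>\<^sub>F n in sequentially. a n \<le> exp (real n * (l + \<kappa>))"
proof -
  \<comment> \<open>For positive \<open>n\<close> a nonpositive \<open>a n\<close> would make the
    term -\<infinity>. At \<open>n = 0\<close> the term is 0 by convention, so that index has to be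
    excluded.\<close>
  have "\<forall>\<^sub>F n in sequentially. ereal (l - 1) < ereal (1 / real n) * eln (a n)"
    using lim by (rule order_tendstoD) simp
  then show pos: "\<forall>\<^sub>F n in sequentially. a n > 0"
    using eventually_gt_at_top[of 0] by eventually_elim (auto simp: eln_def split: if_splits)
  {
    assume "\<kappa> > 0"
    then have "\<forall>\<^sub>F n in sequentially. ereal (l - \<kappa>) < ereal (1 / real n) * eln (a n)"
      by (intro order_tendstoD(1)[OF lim]) simp
    then show "\<forall>\<^sub>F n in sequentially. exp (real n * (l - \<kappa>)) \<le> a n"
      using pos eventually_gt_at_top[of 0]
      by eventually_elim (auto simp: eln_def field_simps ln_ge_iff[symmetric])
  }
  {
    assume "\<kappa> > 0"
    then have "\<forall>\<^sub>F n in sequentially. ereal (1 / real n) * eln (a n) < ereal (l + \<kappa>)"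
      by (intro order_tendstoD(2)[OF lim]) simp
    then show "\<forall>\<^sub>F n in sequentially. a n \<le> exp (real n * (l + \<kappa>))"
      using pos eventually_gt_at_top[of 0]
    proof eventually_elim
      case (elim n)
      then have "ln (a n) \<le> real n * (l + \<kappa>)" by (simp add: eln_def field_simps)
      then have "exp (ln (a n)) \<le> exp (real n * (l + \<kappa>))" by simp
      then show ?case using elim by simp
    qed
  }
qed

locale finite_potential = covariant_flow K C E \<alpha>s \<rho>
  for K C :: "'a::{real_normed_algebra_1, banach} set" and E :: 'a and \<alpha>s :: "'a \<Rightarrow> 'a"
    and \<rho> :: "'a \<Rightarrow> ('x::t2_space \<Rightarrow>\<^sub>C real)" +
  assumes finite: "\<And>\<eta>. \<bar>ext_spectral_potential j E \<eta>\<bar> \<noteq> \<infinity>"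
begin

abbreviation lam :: "('x \<Rightarrow>\<^sub>C real) \<Rightarrow> real" where "lam \<equiv> spectral_potential j E"

lemma ext_eq_lam: "ext_spectral_potential j E \<eta> = ereal (lam \<eta>)"
  using finite[of \<eta>] by (simp add: spectral_potential_def ereal_real)

text \<open>A vanishing power would make all later powers vanish and the potential -\<infinity>.
  From here on the real logarithm can be used in place of \<open>eln\<close>.\<close>

lemma norm_weighted_power_pos: "norm (W \<eta> n) > 0"
proof (rule ccontr)
  assume "\<not> norm (W \<eta> n) > 0"
  then have "W \<eta> n = 0" by simp
  then have zero: "W \<eta> m = 0" if "m \<ge> n" for m
    using power_add[of "weighted j E \<eta>" n "m - n"] that by simp
  have "\<forall>\<^sub>F m in sequentially. ereal (1 / real m) * eln (norm (W \<eta> m)) = - \<infinity>"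
    using eventually_ge_at_top[of n] eventually_gt_at_top[of 0]
  proof eventually_elim
    case (elim m)
    then show ?case using zero[of m] by (simp add: eln_def)
  qed
  then have "ext_spectral_potential j E \<eta> = - \<infinity>"
    unfolding ext_spectral_potential_def by (intro limI tendsto_eventually)
  then show False using finite[of \<eta>] by simp
qed

text \<open>The potential is defined by \<open>lim\<close>, which says nothing before convergence is
  known. Submultiplicativity of the norm and Fekete's lemma provide it, and finiteness makes the
  limit real.\<close>

lemma lam_limit: "(\<lambda>n. ln (norm (W \<eta> n)) / real n) \<longlonglongrightarrow> lam \<eta>"
proof -
  have "ln (norm (W \<eta> (m + n))) \<le> ln (norm (W \<eta> m)) + ln (norm (W \<eta> n))" for m n
  proof -
    have "norm (W \<eta> (m + n)) \<le> norm (W \<eta> m) * norm (W \<eta> n)"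
      by (simp add: power_add norm_mult_ineq)
    then have "ln (norm (W \<eta> (m + n))) \<le> ln (norm (W \<eta> m) * norm (W \<eta> n))"
      using norm_weighted_power_pos[of \<eta> "m + n"] by (simp add: ln_mono)
    also have "\<dots> = ln (norm (W \<eta> m)) + ln (norm (W \<eta> n))"
      using norm_weighted_power_pos[of \<eta>] by (simp add: ln_mult)
    finally show ?thesis .
  qed
  from Fekete[OF this] obtain l where l: "(\<lambda>n. ereal (ln (norm (W \<eta> n)) / real n)) \<longlonglongrightarrow> l" by blast
  have "ereal (1 / real n) * eln (norm (W \<eta> n)) = ereal (ln (norm (W \<eta> n)) / real n)" for n
    using norm_weighted_power_pos[of \<eta> n] by (simp add: eln_def)
  then have "ext_spectral_potential j E \<eta> = l"
    unfolding ext_spectral_potential_def using l by (simp add: limI)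
  then have "l = ereal (lam \<eta>)" by (simp add: ext_eq_lam)
  then show ?thesis using l by simp
qed

lemma lam_lipschitz: "\<bar>lam \<eta> - lam \<xi>\<bar> \<le> norm (\<eta> - \<xi>)"
proof -
  have *: "lam \<eta> \<le> norm (\<eta> - \<xi>) + lam \<xi>" for \<eta> \<xi> :: "'x \<Rightarrow>\<^sub>C real"
  proof (rule LIMSEQ_le[OF lam_limit tendsto_add[OF tendsto_const lam_limit]])
    let ?d = "norm (\<eta> - \<xi>)"
    have "ln (norm (W \<eta> n)) / real n \<le> ?d + ln (norm (W \<xi> n)) / real n" if n: "n > 0" for n
    proof -
      have "norm (W \<eta> n) \<le> norm (j (exp (real n * ?d) *\<^sub>R exp_birkhoff \<xi> n) * E ^ n)"
        unfolding weighted_power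
      proof (rule norm_j_mult_mono)
        fix x
        have "birkhoff \<eta> n x \<le> real n * ?d + birkhoff \<xi> n x"
          using birkhoff_bound[of "\<eta> - \<xi>" n x] by (simp add: birkhoff_diff)
        then show "exp_birkhoff \<eta> n x \<le> (exp (real n * ?d) *\<^sub>R exp_birkhoff \<xi> n) x"
          by (simp add: exp_birkhoff_apply flip: exp_add)
      qed (auto simp: exp_birkhoff_apply K_power E_K)
      also have "\<dots> = exp (real n * ?d) * norm (W \<xi> n)"
        by (simp add: j_scaleR weighted_power)
      finally have "ln (norm (W \<eta> n)) \<le> ln (exp (real n * ?d) * norm (W \<xi> n))"
        using norm_weighted_power_pos by (subst ln_le_cancel_iff) auto
      also have "\<dots> = real n * ?d + ln (norm (W \<xi> n))"
        using norm_weighted_power_pos[of \<xi> n] by (simp add: ln_mult)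
      finally have "ln (norm (W \<eta> n)) / real n \<le> (real n * ?d + ln (norm (W \<xi> n))) / real n"
        by (rule divide_right_mono) simp
      then show ?thesis using n by (simp add: add_divide_distrib)
    qed
    then show "\<exists>N. \<forall>n\<ge>N. ln (norm (W \<eta> n)) / real n \<le> ?d + ln (norm (W \<xi> n)) / real n"
      by (intro exI[of _ 1]) auto
  qed
  show ?thesis using *[of \<eta> \<xi>] *[of \<xi> \<eta>] by (simp add: norm_minus_commute)
qed

lemma lam_convex: "convex_on UNIV lam"
  unfolding convex_on_def
proof (intro conjI ballI allI impI)
  fix \<eta> \<xi> :: "'x \<Rightarrow>\<^sub>C real" and s t :: real
  assume st: "s \<ge> 0" "t \<ge> 0" "s + t = 1"
  let ?N = "\<lambda>\<eta> n. ln (norm (W \<eta> n))"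
  show "lam (s *\<^sub>R \<eta> + t *\<^sub>R \<xi>) \<le> s * lam \<eta> + t * lam \<xi>"
  proof (rule LIMSEQ_le[OF lam_limit])
    show "(\<lambda>n. s * (?N \<eta> n / real n) + t * (?N \<xi> n / real n)) \<longlonglongrightarrow> s * lam \<eta> + t * lam \<xi>"
      by (intro tendsto_intros lam_limit)
    have "?N (s *\<^sub>R \<eta> + t *\<^sub>R \<xi>) n / real n \<le> s * (?N \<eta> n / real n) + t * (?N \<xi> n / real n)" for n
    proof -
      \<comment> \<open>The proof of Hoelder's inequality: convexity of \<open>exp\<close> after normalizing both norms to 1.\<close>
      define A B where "A = ?N \<eta> n" and "B = ?N \<xi> n"
      have A: "norm (W \<eta> n) = exp A" and B: "norm (W \<xi> n) = exp B"
        using norm_weighted_power_pos by (auto simp: A_def B_def)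
      \<comment> \<open>\<open>c\<close> is the weighted geometric mean of the two norms, the bound
        to be reached; \<open>g\<close> is the pointwise majorant given by convexity of
        \<open>exp\<close>, scaled so that its two terms contribute \<open>c * s\<close> and
        \<open>c * t\<close>.\<close>
      define c where "c = exp (s * A + t * B)"
      define g where "g = (c * s * exp (- A)) *\<^sub>R exp_birkhoff \<eta> n + (c * t * exp (- B)) *\<^sub>R exp_birkhoff \<xi> n"
      have "norm (W (s *\<^sub>R \<eta> + t *\<^sub>R \<xi>) n) \<le> norm (j g * E ^ n)"
        unfolding weighted_power
      proof (rule norm_j_mult_mono)
        fix x
        let ?a = "birkhoff \<eta> n x - A" and ?b = "birkhoff \<xi> n x - B"
        have "exp (s * ?a + t * ?b) \<le> s * exp ?a + t * exp ?b"
          using st exp_convex unfolding convex_on_def by auto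
        then have "c * exp (s * ?a + t * ?b) \<le> c * (s * exp ?a + t * exp ?b)"
          by (rule mult_left_mono) (simp add: c_def)
        moreover have "exp_birkhoff (s *\<^sub>R \<eta> + t *\<^sub>R \<xi>) n x = c * exp (s * ?a + t * ?b)"
          unfolding c_def exp_birkhoff_apply birkhoff_add birkhoff_scaleR
          by (simp flip: exp_add add: algebra_simps)
        moreover have "g x = c * (s * exp ?a + t * exp ?b)"
          by (simp add: g_def exp_birkhoff_apply algebra_simps exp_diff exp_minus divide_inverse)
        ultimately show "exp_birkhoff (s *\<^sub>R \<eta> + t *\<^sub>R \<xi>) n x \<le> g x" by simp
      qed (auto simp: exp_birkhoff_apply K_power E_K)
      also have "j g * E ^ n = (c * s * exp (- A)) *\<^sub>R W \<eta> n + (c * t * exp (- B)) *\<^sub>R W \<xi> n"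
        by (simp add: g_def j_add j_scaleR weighted_power algebra_simps)
      also have "norm \<dots> \<le> norm ((c * s * exp (- A)) *\<^sub>R W \<eta> n) + norm ((c * t * exp (- B)) *\<^sub>R W \<xi> n)"
        by (rule norm_triangle_ineq)
      also have "\<dots> = c * s * (exp (- A) * exp A) + c * t * (exp (- B) * exp B)"
        using st by (simp add: A B c_def)
      also have "\<dots> = c * (s + t)"
        by (simp add: algebra_simps flip: exp_add)
      finally have "norm (W (s *\<^sub>R \<eta> + t *\<^sub>R \<xi>) n) \<le> c" using st by simp
      then have "?N (s *\<^sub>R \<eta> + t *\<^sub>R \<xi>) n \<le> ln c"
        using norm_weighted_power_pos by (subst ln_le_cancel_iff) (auto simp: c_def)
      then have "?N (s *\<^sub>R \<eta> + t *\<^sub>R \<xi>) n / real n \<le> (s * A + t * B) / real n"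
        by (intro divide_right_mono) (auto simp: c_def)
      then show ?thesis by (simp add: A_def B_def add_divide_distrib)
    qed
    then show "\<exists>N. \<forall>n\<ge>N. ?N (s *\<^sub>R \<eta> + t *\<^sub>R \<xi>) n / real n \<le> s * (?N \<eta> n / real n) + t * (?N \<xi> n / real n)"
      by blast
  qed
qed simp

lemma norm_weighted_power_upper:
  assumes "\<kappa> > 0"
  shows "\<forall>\<^sub>F n in sequentially. norm (W \<eta> n) \<le> exp (real n * (lam \<eta> + \<kappa>))"
proof -
  have "\<forall>\<^sub>F n in sequentially. ln (norm (W \<eta> n)) / real n < lam \<eta> + \<kappa>"
    using assms by (intro order_tendstoD(2)[OF lam_limit]) simp
  then show ?thesis
    using eventually_gt_at_top[of 0]
  proof eventually_elim
    case (elim n)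
    then have "ln (norm (W \<eta> n)) \<le> real n * (lam \<eta> + \<kappa>)" by (simp add: field_simps)
    then have "exp (ln (norm (W \<eta> n))) \<le> exp (real n * (lam \<eta> + \<kappa>))" by (simp only: exp_le_cancel_iff)
    then show ?case using norm_weighted_power_pos[of \<eta> n] by (simp only: exp_ln)
  qed
qed

end

section \<open>The action functional at a unique subgradient\<close>

text \<open>Testing the infimum in the dual entropy with \<psi> bounds the action of every extension
  of \<open>u\<close>. An extension that is a subgradient on the whole space attains that infimum at
  \<psi>, so the bound is sharp.\<close>

lemma action_on_subgradient:
  fixes F :: "'v::real_normed_vector \<Rightarrow> real"
  assumes convex: "convex_on UNIV F" and Lip: "\<And>x y. \<bar>F x - F y\<bar> \<le> norm (x - y)"
    and L: "subspace L" "\<phi> \<in> L" "\<psi> \<in> L" and u: "u \<in> subgradients_on L F \<psi>"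
  shows "action_on L F \<phi> u = ereal (F \<psi> - F \<phi> - u (\<psi> - \<phi>))"
  unfolding action_on_def
proof (rule Sup_eqI)
  have diff: "\<mu> (\<psi> - \<phi>) = u (\<psi> - \<phi>)" if "restrict (blinfun_apply \<mu>) L = u" for \<mu> :: "'v \<Rightarrow>\<^sub>L real"
    using that subspace_diff[OF L(1) L(3) L(2)] by auto
  fix y assume "y \<in> {action F \<phi> \<mu> | \<mu>. restrict (blinfun_apply \<mu>) L = u}"
  then obtain \<mu> :: "'v \<Rightarrow>\<^sub>L real" where \<mu>: "y = action F \<phi> \<mu>" "restrict (blinfun_apply \<mu>) L = u" by auto
  have "dual_entropy F \<mu> \<le> ereal (F \<psi> - \<mu> \<psi>)"
    unfolding dual_entropy_def by (rule INF_lower) simp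
  then have "y \<le> ereal (\<mu> \<phi>) + ereal (F \<psi> - \<mu> \<psi>) - ereal (F \<phi>)"
    unfolding \<mu>(1) action_def by (intro ereal_minus_mono add_left_mono) auto
  also have "\<dots> = ereal (F \<psi> - F \<phi> - u (\<psi> - \<phi>))"
    using diff[OF \<mu>(2)] by (simp add: blinfun.diff_right)
  finally show "y \<le> ereal (F \<psi> - F \<phi> - u (\<psi> - \<phi>))" .
next
  fix z assume z: "\<And>y. y \<in> {action F \<phi> \<mu> | \<mu>. restrict (blinfun_apply \<mu>) L = u} \<Longrightarrow> y \<le> z"
  obtain \<mu> :: "'v \<Rightarrow>\<^sub>L real" where \<mu>: "restrict (blinfun_apply \<mu>) L = u" "\<And>x. \<mu> x \<le> F (\<psi> + x) - F \<psi>"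
    using subgradient_extends[OF convex Lip L(1) u] by auto
  have "dual_entropy F \<mu> \<ge> ereal (F \<psi> - \<mu> \<psi>)"
    unfolding dual_entropy_def
  proof (rule INF_greatest)
    fix x show "ereal (F \<psi> - \<mu> \<psi>) \<le> ereal (F x - \<mu> x)"
      using \<mu>(2)[of "x - \<psi>"] by (simp add: blinfun.diff_right)
  qed
  then have "ereal (\<mu> \<phi>) + ereal (F \<psi> - \<mu> \<psi>) - ereal (F \<phi>) \<le> action F \<phi> \<mu>"
    unfolding action_def by (intro ereal_minus_mono add_left_mono) auto
  moreover have "\<mu> (\<psi> - \<phi>) = u (\<psi> - \<phi>)"
    using \<mu>(1) subspace_diff[OF L(1) L(3) L(2)] by auto
  then have "\<mu> \<phi> + (F \<psi> - \<mu> \<psi>) - F \<phi> = F \<psi> - F \<phi> - u (\<psi> - \<phi>)"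
    by (simp add: blinfun.diff_right)
  ultimately have "ereal (F \<psi> - F \<phi> - u (\<psi> - \<phi>)) \<le> action F \<phi> \<mu>"
    by simp
  also have "\<dots> \<le> z" using \<mu>(1) by (intro z) auto
  finally show "ereal (F \<psi> - F \<phi> - u (\<psi> - \<phi>)) \<le> z" .
qed

lemma openin_weak_star_slab:
  assumes "\<eta> \<in> L"
  shows "openin (weak_star L) {v \<in> dual_on L. \<bar>v \<eta> - c\<bar> < r}"
proof -
  have "openin (product_topology (\<lambda>_. euclideanreal) L)
      {v \<in> topspace (product_topology (\<lambda>_. euclideanreal) L). v \<eta> \<in> {y. \<bar>y - c\<bar> < r}}"
    by (rule openin_continuous_map_preimage[OF continuous_map_product_projection[OF assms]])
      (auto intro!: open_Collect_less continuous_intros)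
  moreover have "{v \<in> dual_on L. \<bar>v \<eta> - c\<bar> < r} =
      {v \<in> topspace (product_topology (\<lambda>_. euclideanreal) L). v \<eta> \<in> {y. \<bar>y - c\<bar> < r}} \<inter> dual_on L"
    by (auto simp: dual_on_def PiE_def)
  ultimately show ?thesis
    unfolding weak_star_def openin_subtopology by blast
qed

section \<open>Empirical measures and their exponential moments\<close>

context covariant_flow
begin

lemma empirical_birkhoff: "empirical \<alpha> n x \<eta> = birkhoff \<eta> n x / real n"
  by (simp add: empirical_def birkhoff_def)

text \<open>Ensures that whether an empirical measure lies in a slab of \<open>dual_on L\<close>
  depends on a single value only.\<close>

lemma empirical_dual_on:
  assumes L: "subspace L"
  shows "restrict (empirical \<alpha> n x) L \<in> dual_on L"
proof -
  have "\<bar>empirical \<alpha> n x f\<bar> \<le> 1 * norm f" for f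
  proof (cases "n = 0")
    case False
    then show ?thesis
      using birkhoff_bound[of f n x] by (simp add: empirical_birkhoff field_simps)
  qed (simp add: empirical_birkhoff)
  then show ?thesis
    unfolding dual_on_def
    by (auto simp: empirical_birkhoff birkhoff_add birkhoff_scaleR add_divide_distrib
        subspace_add[OF L] subspace_scale[OF L] intro!: exI[of _ 1])
qed

lemma riesz_prob_exp_birkhoff:
  assumes P: "riesz_prob M (\<lambda>g. \<nu> (j g * W \<phi> n) / \<nu> (W \<phi> n))" and n: "n > 0"
  shows "(\<integral>x. exp (real n * c * empirical \<alpha> n x \<eta>) \<partial>M) = \<nu> (W (\<phi> + c *\<^sub>R \<eta>) n) / \<nu> (W \<phi> n)"
proof -
  have "(\<integral>x. exp (real n * c * empirical \<alpha> n x \<eta>) \<partial>M) = (\<integral>x. exp_birkhoff (c *\<^sub>R \<eta>) n x \<partial>M)"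
    using n by (simp add: exp_birkhoff_apply birkhoff_scaleR empirical_birkhoff)
  also have "\<dots> = \<nu> (j (exp_birkhoff (c *\<^sub>R \<eta>) n) * W \<phi> n) / \<nu> (W \<phi> n)"
    using P by (simp add: riesz_prob_def)
  finally show ?thesis by (simp add: weighted_power_shift)
qed

end

context finite_potential
begin

text \<open>Continuity of the state suffices for an upper rate at every weight: the constant
  \<open>norm \<nu>\<close> is absorbed by half of \<kappa>.\<close>

lemma state_weighted_power_upper:
  assumes "\<kappa> > 0"
  shows "\<forall>\<^sub>F n in sequentially. blinfun_apply \<nu> (W \<eta> n) \<le> exp (real n * (lam \<eta> + \<kappa>))"
proof -
  have "filterlim (\<lambda>n. exp (real n * (\<kappa> / 2))) at_top sequentially"
    using assms by real_asymp
  then have "\<forall>\<^sub>F n in sequentially. norm \<nu> \<le> exp (real n * (\<kappa> / 2))"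
    by (simp add: filterlim_at_top)
  moreover have "\<forall>\<^sub>F n in sequentially. norm (W \<eta> n) \<le> exp (real n * (lam \<eta> + \<kappa> / 2))"
    using assms by (intro norm_weighted_power_upper) simp
  ultimately show ?thesis
  proof eventually_elim
    case (elim n)
    have "blinfun_apply \<nu> (W \<eta> n) \<le> norm \<nu> * norm (W \<eta> n)"
      using norm_blinfun[of \<nu> "W \<eta> n"] by simp
    also have "\<dots> \<le> exp (real n * (\<kappa> / 2)) * exp (real n * (lam \<eta> + \<kappa> / 2))"
      using elim by (intro mult_mono) auto
    also have "\<dots> = exp (real n * (lam \<eta> + \<kappa>))"
      by (simp flip: exp_add add: algebra_simps)
    finally show ?case .
  qed
qed

lemma empirical_local_large_deviation:
  fixes \<phi> \<psi> :: "'x \<Rightarrow>\<^sub>C real"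
  assumes L: "subspace L" "\<phi> \<in> L" "\<psi> \<in> L"
    and \<nu>: "sensitive j E \<nu> \<phi>" "sensitive j E \<nu> \<psi>"
    and P: "\<And>n. \<nu> (W \<phi> n) > 0 \<Longrightarrow> riesz_prob (P n) (\<lambda>g. \<nu> (j g * W \<phi> n) / \<nu> (W \<phi> n))"
    and unique: "subgradients_on L lam \<psi> = {u}" and \<epsilon>: "\<epsilon> > 0"
  defines "\<eta> \<equiv> \<psi> - \<phi>"
  defines "A n \<equiv> {x. \<bar>empirical \<alpha> n x \<eta> - u \<eta>\<bar> < \<epsilon> / 2}"
    and "\<tau> \<equiv> lam \<psi> - lam \<phi> - u \<eta>"
  shows "\<forall>\<^sub>F n in sequentially. exp (real n * (\<tau> - \<epsilon>)) < measure (P n) (A n) \<and>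
    measure (P n) (A n) < exp (real n * (\<tau> + \<epsilon>))"
proof -
  \<comment> \<open>The candidate rate of the moments along the line through \<phi> and \<psi>; the
    tilt \<open>c = 1\<close> lands on \<psi>.\<close>
  define \<Lambda> where "\<Lambda> c = lam (\<phi> + c *\<^sub>R \<eta>) - lam \<phi>" for c
  have \<Lambda>1: "\<Lambda> 1 = lam \<psi> - lam \<phi>" by (simp add: \<Lambda>_def \<eta>_def)
  have \<eta>: "\<eta> \<in> L" unfolding \<eta>_def by (rule subspace_diff) (use L in auto)
  note lim = \<nu>[unfolded sensitive_def ext_eq_lam]
  note Z\<phi> = tendsto_scaled_eln[OF lim(1)] and Z\<psi> = tendsto_scaled_eln[OF lim(2)]
  have mgf: "\<forall>\<^sub>F n in sequentially. \<nu> (W \<phi> n) > 0 \<and> sets (P n) = sets borel \<and> prob_space (P n) \<and>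
    (\<forall>c. (\<integral>x. exp (real n * c * empirical \<alpha> n x \<eta>) \<partial>P n) = \<nu> (W (\<phi> + c *\<^sub>R \<eta>) n) / \<nu> (W \<phi> n))"
    using Z\<phi>(1) eventually_gt_at_top[of 0]
  proof eventually_elim
    case (elim n)
    then have "riesz_prob (P n) (\<lambda>g. \<nu> (j g * W \<phi> n) / \<nu> (W \<phi> n))" by (intro P)
    then show ?case
      using elim riesz_prob_exp_birkhoff by (auto simp: riesz_prob_def)
  qed
  have "\<forall>\<^sub>F n in sequentially.
    exp (real n * (\<Lambda> 1 - u \<eta> - \<epsilon>)) < measure (P n) {x \<in> space (P n). \<bar>empirical \<alpha> n x \<eta> - u \<eta>\<bar> < \<epsilon> / 2} \<and>
    measure (P n) {x \<in> space (P n). \<bar>empirical \<alpha> n x \<eta> - u \<eta>\<bar> < \<epsilon> / 2} < exp (real n * (\<Lambda> 1 - u \<eta> + \<epsilon>))"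
  proof (rule local_large_deviation)
    show "\<forall>\<^sub>F n in sequentially. prob_space (P n) \<and> (\<lambda>x. empirical \<alpha> n x \<eta>) \<in> borel_measurable (P n)"
      using mgf
    proof eventually_elim
      case (elim n)
      have "(\<lambda>x. empirical \<alpha> n x \<eta>) \<in> borel_measurable borel"
        unfolding empirical_birkhoff divide_inverse
        by (intro borel_measurable_continuous_onI continuous_intros birkhoff_continuous)
      then show ?case using elim measurable_cong_sets[of "P n" borel] by auto
    qed
    show "\<bar>empirical \<alpha> n x \<eta>\<bar> \<le> norm \<eta>" for n x
      using birkhoff_bound[of \<eta> n x] by (cases "n = 0") (simp_all add: empirical_birkhoff field_simps)
  next
    fix c \<kappa> :: real assume \<kappa>: "\<kappa> > 0"
    \<comment> \<open>Numerator and denominator of the moment each use up half of the allowed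
      error.\<close>
    then have "\<kappa> / 2 > 0" by simp
    from mgf Z\<phi>(2)[OF this] state_weighted_power_upper[OF this, of \<nu> "\<phi> + c *\<^sub>R \<eta>"]
    show "\<forall>\<^sub>F n in sequentially.
        (\<integral>x. exp (real n * c * empirical \<alpha> n x \<eta>) \<partial>P n) \<le> exp (real n * (\<Lambda> c + \<kappa>))"
    proof eventually_elim
      case (elim n)
      then have "\<nu> (W (\<phi> + c *\<^sub>R \<eta>) n) / \<nu> (W \<phi> n)
          \<le> exp (real n * (lam (\<phi> + c *\<^sub>R \<eta>) + \<kappa> / 2)) / exp (real n * (lam \<phi> - \<kappa> / 2))"
        by (intro frac_le) auto
      also have "\<dots> = exp (real n * (\<Lambda> c + \<kappa>))"
        by (simp add: \<Lambda>_def algebra_simps flip: exp_diff)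
      finally show ?case using elim by simp
    qed
  next
    fix \<kappa> :: real assume \<kappa>: "\<kappa> > 0"
    then have "\<kappa> / 2 > 0" by simp
    from mgf Z\<phi>(3)[OF this] Z\<psi>(2)[OF this]
    show "\<forall>\<^sub>F n in sequentially.
        exp (real n * (\<Lambda> 1 - \<kappa>)) \<le> (\<integral>x. exp (real n * 1 * empirical \<alpha> n x \<eta>) \<partial>P n)"
    proof eventually_elim
      case (elim n)
      have "exp (real n * (\<Lambda> 1 - \<kappa>)) = exp (real n * (lam \<psi> - \<kappa> / 2)) / exp (real n * (lam \<phi> + \<kappa> / 2))"
        by (simp add: \<Lambda>1 algebra_simps flip: exp_diff)
      also have "\<dots> \<le> \<nu> (W \<psi> n) / \<nu> (W \<phi> n)"
        using elim by (intro frac_le) (auto intro: less_imp_le less_le_trans[OF exp_gt_zero])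
      also have "\<psi> = \<phi> + 1 *\<^sub>R \<eta>" by (simp add: \<eta>_def)
      finally show ?case using elim by metis
    qed
  next
    fix r :: real assume r: "r > 0"
    \<comment> \<open>Moving \<open>c\<close> away from 1 means moving from \<psi> along \<eta> or
      \<open>- \<eta>\<close>, so the left slope comes from the one-sided result in the opposite
      direction.\<close>
    have "\<phi> + (1 + t) *\<^sub>R \<eta> = \<psi> + t *\<^sub>R \<eta>" "\<phi> + (1 - t) *\<^sub>R \<eta> = \<psi> + t *\<^sub>R (- \<eta>)" for t
      by (simp_all add: \<eta>_def algebra_simps)
    then have \<Lambda>: "\<Lambda> (1 + t) = lam (\<psi> + t *\<^sub>R \<eta>) - lam \<phi>" "\<Lambda> (1 - t) = lam (\<psi> + t *\<^sub>R (- \<eta>)) - lam \<phi>" for t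
      by (simp_all only: \<Lambda>_def)
    note dir = unique_subgradient_directional[OF lam_convex lam_lipschitz L(1) unique _ r]
    show "\<exists>t>0. \<Lambda> (1 + t) \<le> \<Lambda> 1 + t * (u \<eta> + r)"
      using dir[OF \<eta>] by (simp add: \<Lambda> \<Lambda>1)
    have "u \<in> dual_on L" using unique by (auto simp: subgradients_on_def)
    then have "u (- 1 *\<^sub>R \<eta>) = - 1 * u \<eta>" using \<eta> unfolding dual_on_def by blast
    then have "\<exists>t>0. lam (\<psi> + t *\<^sub>R (- \<eta>)) \<le> lam \<psi> + t * (- u \<eta> + r)"
      using dir[OF subspace_neg[OF L(1) \<eta>]] by simp
    then show "\<exists>t>0. \<Lambda> (1 - t) \<le> \<Lambda> 1 - t * (u \<eta> - r)"
      unfolding \<Lambda> \<Lambda>1 by (auto simp: algebra_simps)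
  qed fact
  then show ?thesis
    using mgf
  proof eventually_elim
    case (elim n)
    have "space (P n) = UNIV" using elim sets_eq_imp_space_eq[of "P n" borel] by simp
    then show ?case using elim by (simp add: \<tau>_def A_def \<Lambda>1)
  qed
qed

end

theorem corollary7p4:
  fixes K C :: "'a::{real_normed_algebra_1, banach} set"
    and E :: 'a
    and \<alpha>s :: "'a \<Rightarrow> 'a"
    and \<rho> :: "'a \<Rightarrow> ('x::t2_space \<Rightarrow>\<^sub>C real)"
    and j :: "('x \<Rightarrow>\<^sub>C real) \<Rightarrow> 'a"
    and \<alpha> :: "'x \<Rightarrow> 'x"
    and lam :: "('x \<Rightarrow>\<^sub>C real) \<Rightarrow> real"
    and L :: "('x \<Rightarrow>\<^sub>C real) set"
    and \<phi> \<psi> :: "'x \<Rightarrow>\<^sub>C real"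
    and \<nu> :: "'a \<Rightarrow>\<^sub>L real"
    and P :: "nat \<Rightarrow> 'x measure"
    and u :: "('x \<Rightarrow>\<^sub>C real) \<Rightarrow> real"
    and \<tau> :: real
  assumes flow: "covariant_positive_flow K C E \<alpha>s"
    and phase: "phase_isomorphism K C \<rho>"
    and j_def: "j = phase_embedding C \<rho>"
    and \<alpha>_def: "\<alpha> = phase_map C \<rho> \<alpha>s"
    and lam_finite: "\<And>\<eta>. \<bar>ext_spectral_potential j E \<eta>\<bar> \<noteq> \<infinity>"
    and lam_def: "lam = spectral_potential j E"
    and L: "subspace L" "\<phi> \<in> L" "\<psi> \<in> L"
    and \<nu>: "state K \<nu>" "sensitive j E \<nu> \<phi>" "sensitive j E \<nu> \<psi>"
    and P: "\<And>n. \<nu> (weighted j E \<phi> ^ n) > 0 \<Longrightarrow>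
              riesz_prob (P n)
                (\<lambda>g. \<nu> (j g * weighted j E \<phi> ^ n) / \<nu> (weighted j E \<phi> ^ n))"
    and unique: "subgradients_on L lam \<psi> = {u}"
    and \<tau>_def: "\<tau> = lam \<psi> - lam \<phi> - u (\<psi> - \<phi>)"
  shows "action_on L lam \<phi> u = ereal \<tau> \<and>
    (\<forall>\<epsilon>>0. \<exists>U. openin (weak_star L) U \<and> u \<in> U \<and>
       (\<forall>\<^sub>F n in sequentially.
          exp (real n * (\<tau> - \<epsilon>)) < measure (P n) {x. restrict (empirical \<alpha> n x) L \<in> U} \<and>
          measure (P n) {x. restrict (empirical \<alpha> n x) L \<in> U} < exp (real n * (\<tau> + \<epsilon>))))"
proof -
  interpret covariant_flow K C E \<alpha>s \<rho>
    using flow phase by unfold_locales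
  interpret finite_potential K C E \<alpha>s \<rho>
    using lam_finite unfolding j_def by unfold_locales
  note [simp] = j_def \<alpha>_def lam_def
  have u: "u \<in> subgradients_on L lam \<psi>" using unique by simp
  have "action_on L lam \<phi> u = ereal \<tau>"
    using action_on_subgradient[OF lam_convex lam_lipschitz L] u by (simp add: \<tau>_def)
  moreover have "\<exists>U. openin (weak_star L) U \<and> u \<in> U \<and>
       (\<forall>\<^sub>F n in sequentially.
          exp (real n * (\<tau> - \<epsilon>)) < measure (P n) {x. restrict (empirical \<alpha> n x) L \<in> U} \<and>
          measure (P n) {x. restrict (empirical \<alpha> n x) L \<in> U} < exp (real n * (\<tau> + \<epsilon>)))"
    if \<epsilon>: "\<epsilon> > 0" for \<epsilon>
  proof -
    define \<eta> where "\<eta> = \<psi> - \<phi>"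
    \<comment> \<open>The radius \<open>\<epsilon> / 2\<close> is the one in the local estimate:
      removing the tilt on the slab causes an exponential error of that size, leaving the other half
      of \<epsilon> for the errors in the rates.\<close>
    define U where "U = {v \<in> dual_on L. \<bar>v \<eta> - u \<eta>\<bar> < \<epsilon> / 2}"
    have \<eta>: "\<eta> \<in> L" unfolding \<eta>_def using L by (intro subspace_diff)
    have "{x. restrict (empirical \<alpha> n x) L \<in> U} = {x. \<bar>empirical \<alpha> n x \<eta> - u \<eta>\<bar> < \<epsilon> / 2}" for n
      using \<eta> empirical_dual_on[OF L(1), of n] by (auto simp: U_def)
    moreover have "openin (weak_star L) U"
      unfolding U_def by (rule openin_weak_star_slab[OF \<eta>])
    moreover have "u \<in> U"
      using u \<epsilon> by (auto simp: U_def subgradients_on_def)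
    ultimately show ?thesis
      using empirical_local_large_deviation[OF L, of \<nu> P u \<epsilon>] \<nu> P unique \<epsilon>
      by (intro exI[of _ U]) (simp add: \<eta>_def \<tau>_def)
  qed
  ultimately show ?thesis by blast
qed

end
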